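(* Let $\mathsf{M},\mathsf{N}$ be model categories, let $i:\mathsf{M}_c\hookrightarrow\mathsf{M}$ be the inclusion of the full subcategory of cofibrant objects, and let $F:\mathsf{M}\to\mathsf{N}$ be a functor that sends weak equivalences between cofibrant objects to weak equivalences. Then the Kan extension derived functor $$\mathbb{L}^{K}F=(\mathcal{L}_{\mathsf M}\circ i)_*(\mathcal{L}_{\mathsf N}\circ F\circ i):\mathsf{Ho}_K(\mathsf{M})\to\mathsf{Ho}_K(\mathsf{N}),$$ i.e. the right Kan extension of $\mathcal{L}_{\mathsf N}\circ F\circ i$ along $\mathcal{L}_{\mathsf M}\circ i$, exists and is given by the F total derived functor $\mathbb{L}^{F}F=\mathbf{L}^{F}(\mathcal{L}_{\mathsf N}\circ F\circ i)$.
   Context: All model categories are assumed to admit functorial factorizations. Objects connected by a unique or canonical isomorphism are identified. The Kan homotopy category $\mathsf{Ho}_K(\mathsf{M})$ has as objects the fibrant-cofibrant objects of $\mathsf{M}$ and as morphisms homotopy classes $[f]$ of $\mathsf{M}$-morphisms. Its localization functor $\mathcal{L}_{\mathsf M}:\mathsf{M}\to\mathsf{Ho}_K(\mathsf{M})$ is $\mathcal{L}_{\mathsf M}X=\tilde F\tilde C X$, $\mathcal{L}_{\mathsf M}f=[\tilde F\tilde C f]$. Here, for every object $X$, $0\to\tilde C X\xrightarrow{c_X}X$ is a chosen factorization into a cofibration followed by a trivial fibration with $c_X=\mathrm{id}_X$ for $X$ cofibrant, and $X\xrightarrow{f_X}\tilde F X\to *$ is a chosen factorization into a trivial cofibration followed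 by a fibration with $f_X=\mathrm{id}_X$ for $X$ fibrant; $\tilde C f$ is any lift with $c_Y\circ\tilde C f=f\circ c_X$ and $\tilde F g$ any lift with $\tilde F g\circ f_A=f_B\circ g$ for $g:A\to B$. Similarly for $\mathsf{N}$. Weak equivalences of $\mathsf{M}_c$ are the weak equivalences of $\mathsf{M}$ between cofibrant objects; their class is also denoted $W$. The pair $(\mathsf{Ho}_K(\mathsf{M}),\mathcal{L}_{\mathsf M}\circ i)$ is a faint localization of $\mathsf{M}_c$ at $W$, where a faint localization of $\mathsf{C}$ at $W$ is a functor $L:\mathsf{C}\to\mathsf{C}[W^{-1}]$ sending $W$ to isomorphisms such that: (L1) every functor $G:\mathsf{C}\to\mathsf{D}$ sending $W$ to isomorphisms admits a functor $\bar G:\mathsf{C}[W^{-1}]\to\mathsf{D}$ and a natural isomorphism $\eta:G\Rightarrow\bar G\circ L$; (L2) if $(\bar G',\eta')$ is another such pair there is a unique natural isomorphism $\epsilon:\bar G\Rightarrow\bar G'$ with $(\epsilon\star L)\circ\eta=\eta'$, $\star$ denoting whiskering. F derived functor: $\mathbb{L}^FF=\mathbf{L}^F(\mathcal{L}_{\mathsf N}\circ F\circ i)$ is the functor $\mathsf{Ho}_K(\mathsf{M})\to\mathsf{Ho}_K(\mathsf{N})$ provided by this faint universal property for $G=\mathcal{L}_{\mathsf N}\circ F\circ i$; it comes with a natural isomorphism $\iota:\mathbb{L}^FF\circ\mathcal{L}_{\mathsf M}\circ i\Rightarrow\mathcal{L}_{\mathsf N}\circ F\circ i$, and the pair is unique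 up to unique natural isomorphism. Right Kan extension of $G:\mathsf{C}\to\mathsf{D}$ along $P:\mathsf{C}\to\mathsf{C}'$: a functor $P_*G:\mathsf{C}'\to\mathsf{D}$ with a natural transformation $\varepsilon:P_*G\circ P\Rightarrow G$ such that for every $H:\mathsf{C}'\to\mathsf{D}$ and every natural transformation $\zeta:H\circ P\Rightarrow G$ there is a unique natural transformation $\theta:H\Rightarrow P_*G$ with $\varepsilon\circ(\theta\star P)=\zeta$. That the Kan extension "is given by" a functor means that this functor, equipped with a suitable natural transformation, is such a universal pair. *)

theory Defs
  imports Main "HOL-Library.FuncSet"
begin

section \<open>Categories, functors, natural transformations\<close>

text \<open>\<open>Comp C g f\<close> is the composite g after f; it is meaningful only when
  \<open>Cod C f = Dom C g\<close>.\<close>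

record ('o, 'a) cat =
  Obj :: "'o set"
  Arr :: "'a set"
  Dom :: "'a \<Rightarrow> 'o"
  Cod :: "'a \<Rightarrow> 'o"
  Ident :: "'o \<Rightarrow> 'a"
  Comp :: "'a \<Rightarrow> 'a \<Rightarrow> 'a"

definition hom :: "('o, 'a, 'z) cat_scheme \<Rightarrow> 'o \<Rightarrow> 'o \<Rightarrow> 'a set" where
  "hom C X Y = {f \<in> Arr C. Dom C f = X \<and> Cod C f = Y}"

definition category :: "('o, 'a, 'z) cat_scheme \<Rightarrow> bool" where
  "category C \<longleftrightarrow>
    (\<forall>f\<in>Arr C. Dom C f \<in> Obj C \<and> Cod C f \<in> Obj C) \<and>
    (\<forall>X\<in>Obj C. Ident C X \<in> hom C X X) \<and>
    (\<forall>X Y Z f g. f \<in> hom C X Y \<longrightarrow> g \<in> hom C Y Z \<longrightarrow> Comp C g f \<in> hom C X Z) \<and>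
    (\<forall>X Y f. f \<in> hom C X Y \<longrightarrow> Comp C f (Ident C X) = f \<and> Comp C (Ident C Y) f = f) \<and>
    (\<forall>W X Y Z f g h. f \<in> hom C W X \<longrightarrow> g \<in> hom C X Y \<longrightarrow> h \<in> hom C Y Z \<longrightarrow>
       Comp C h (Comp C g f) = Comp C (Comp C h g) f)"

definition is_iso :: "('o, 'a, 'z) cat_scheme \<Rightarrow> 'a \<Rightarrow> bool" where
  "is_iso C f \<longleftrightarrow> f \<in> Arr C \<and>
    (\<exists>g\<in>hom C (Cod C f) (Dom C f).
       Comp C g f = Ident C (Dom C f) \<and> Comp C f g = Ident C (Cod C f))"

definition op_cat :: "('o, 'a, 'z) cat_scheme \<Rightarrow> ('o, 'a) cat" where
  "op_cat C = \<lparr>Obj = Obj C, Arr = Arr C, Dom = Cod C, Cod = Dom C,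
     Ident = Ident C, Comp = (\<lambda>g f. Comp C f g)\<rparr>"

definition full_subcat :: "('o, 'a, 'z) cat_scheme \<Rightarrow> 'o set \<Rightarrow> ('o, 'a) cat" where
  "full_subcat C S = \<lparr>Obj = Obj C \<inter> S,
     Arr = {f \<in> Arr C. Dom C f \<in> S \<and> Cod C f \<in> S},
     Dom = Dom C, Cod = Cod C, Ident = Ident C, Comp = Comp C\<rparr>"

record ('o, 'a, 'p, 'b) cat_functor =
  Fob :: "'o \<Rightarrow> 'p"
  Far :: "'a \<Rightarrow> 'b"

definition is_functor ::
  "('o, 'a, 'y) cat_scheme \<Rightarrow> ('p, 'b, 'z) cat_scheme \<Rightarrow> ('o, 'a, 'p, 'b) cat_functor \<Rightarrow> bool" where
  "is_functor C D F \<longleftrightarrow> category C \<and> category D \<and>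
    (\<forall>X\<in>Obj C. Fob F X \<in> Obj D) \<and>
    (\<forall>f\<in>Arr C. Far F f \<in> hom D (Fob F (Dom C f)) (Fob F (Cod C f))) \<and>
    (\<forall>X\<in>Obj C. Far F (Ident C X) = Ident D (Fob F X)) \<and>
    (\<forall>X Y Z f g. f \<in> hom C X Y \<longrightarrow> g \<in> hom C Y Z \<longrightarrow>
       Far F (Comp C g f) = Comp D (Far F g) (Far F f))"

definition fcomp ::
  "('p, 'b, 'q, 'c) cat_functor \<Rightarrow> ('o, 'a, 'p, 'b) cat_functor \<Rightarrow> ('o, 'a, 'q, 'c) cat_functor" where
  "fcomp G F = \<lparr>Fob = Fob G \<circ> Fob F, Far = Far G \<circ> Far F\<rparr>"

definition inclusion :: "('o, 'a, 'o, 'a) cat_functor" where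
  "inclusion = \<lparr>Fob = id, Far = id\<rparr>"

text \<open>Families of components are required to be extensional, so that HOL equality of families
  is equality of natural transformations (this matters for \<open>\<exists>!\<close> below).\<close>

definition nat_trans ::
  "('o, 'a, 'y) cat_scheme \<Rightarrow> ('p, 'b, 'z) cat_scheme \<Rightarrow>
   ('o, 'a, 'p, 'b) cat_functor \<Rightarrow> ('o, 'a, 'p, 'b) cat_functor \<Rightarrow> ('o \<Rightarrow> 'b) \<Rightarrow> bool" where
  "nat_trans C D F G \<tau> \<longleftrightarrow> is_functor C D F \<and> is_functor C D G \<and>
    \<tau> \<in> extensional (Obj C) \<and>
    (\<forall>X\<in>Obj C. \<tau> X \<in> hom D (Fob F X) (Fob G X)) \<and>
    (\<forall>f\<in>Arr C. Comp D (\<tau> (Cod C f)) (Far F f) = Comp D (Far G f) (\<tau> (Dom C f)))"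

definition nat_iso ::
  "('o, 'a, 'y) cat_scheme \<Rightarrow> ('p, 'b, 'z) cat_scheme \<Rightarrow>
   ('o, 'a, 'p, 'b) cat_functor \<Rightarrow> ('o, 'a, 'p, 'b) cat_functor \<Rightarrow> ('o \<Rightarrow> 'b) \<Rightarrow> bool" where
  "nat_iso C D F G \<tau> \<longleftrightarrow> nat_trans C D F G \<tau> \<and> (\<forall>X\<in>Obj C. is_iso D (\<tau> X))"

definition vcomp ::
  "('o, 'a, 'y) cat_scheme \<Rightarrow> ('p, 'b, 'z) cat_scheme \<Rightarrow> ('o \<Rightarrow> 'b) \<Rightarrow> ('o \<Rightarrow> 'b) \<Rightarrow> ('o \<Rightarrow> 'b)" where
  "vcomp C D \<sigma> \<tau> = restrict (\<lambda>X. Comp D (\<sigma> X) (\<tau> X)) (Obj C)"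

definition whisker ::
  "('o, 'a, 'y) cat_scheme \<Rightarrow> ('p \<Rightarrow> 'c) \<Rightarrow> ('o, 'a, 'p, 'b) cat_functor \<Rightarrow> ('o \<Rightarrow> 'c)" where
  "whisker C \<theta> P = restrict (\<lambda>X. \<theta> (Fob P X)) (Obj C)"

definition right_Kan_extension ::
  "('o, 'a, 'x) cat_scheme \<Rightarrow> ('p, 'b, 'y) cat_scheme \<Rightarrow> ('q, 'c, 'z) cat_scheme \<Rightarrow>
   ('o, 'a, 'p, 'b) cat_functor \<Rightarrow> ('o, 'a, 'q, 'c) cat_functor \<Rightarrow>
   ('p, 'b, 'q, 'c) cat_functor \<Rightarrow> ('o \<Rightarrow> 'c) \<Rightarrow> bool" where
  "right_Kan_extension C C' D P G K \<epsilon> \<longleftrightarrow>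
    is_functor C C' P \<and> is_functor C D G \<and>
    is_functor C' D K \<and> nat_trans C D (fcomp K P) G \<epsilon> \<and>
    (\<forall>H \<zeta>. is_functor C' D H \<longrightarrow> nat_trans C D (fcomp H P) G \<zeta> \<longrightarrow>
       (\<exists>!\<theta>. nat_trans C' D H K \<theta> \<and> vcomp C D \<epsilon> (whisker C \<theta> P) = \<zeta>))"


section \<open>Limits and colimits\<close>

definition is_cone ::
  "('j, 'k, 'y) cat_scheme \<Rightarrow> ('o, 'a, 'z) cat_scheme \<Rightarrow> ('j, 'k, 'o, 'a) cat_functor \<Rightarrow>
   'o \<Rightarrow> ('j \<Rightarrow> 'a) \<Rightarrow> bool" where
  "is_cone J C D X \<pi> \<longleftrightarrow> X \<in> Obj C \<and>
    (\<forall>j\<in>Obj J. \<pi> j \<in> hom C X (Fob D j)) \<and>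
    (\<forall>k\<in>Arr J. Comp C (Far D k) (\<pi> (Dom J k)) = \<pi> (Cod J k))"

definition is_limit ::
  "('j, 'k, 'y) cat_scheme \<Rightarrow> ('o, 'a, 'z) cat_scheme \<Rightarrow> ('j, 'k, 'o, 'a) cat_functor \<Rightarrow>
   'o \<Rightarrow> ('j \<Rightarrow> 'a) \<Rightarrow> bool" where
  "is_limit J C D X \<pi> \<longleftrightarrow> is_cone J C D X \<pi> \<and>
    (\<forall>Y \<rho>. is_cone J C D Y \<rho> \<longrightarrow>
       (\<exists>!u. u \<in> hom C Y X \<and> (\<forall>j\<in>Obj J. Comp C (\<pi> j) u = \<rho> j)))"

text \<open>Every finite category is isomorphic to one whose objects and arrows are natural numbers.\<close>

definition has_finite_limits :: "('o, 'a, 'z) cat_scheme \<Rightarrow> bool" where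
  "has_finite_limits C \<longleftrightarrow>
    (\<forall>(J :: (nat, nat) cat) D. finite (Obj J) \<longrightarrow> finite (Arr J) \<longrightarrow> is_functor J C D \<longrightarrow>
       (\<exists>X \<pi>. is_limit J C D X \<pi>))"

definition has_finite_colimits :: "('o, 'a, 'z) cat_scheme \<Rightarrow> bool" where
  "has_finite_colimits C \<longleftrightarrow> has_finite_limits (op_cat C)"

definition is_initial :: "('o, 'a, 'z) cat_scheme \<Rightarrow> 'o \<Rightarrow> bool" where
  "is_initial C Z \<longleftrightarrow> Z \<in> Obj C \<and> (\<forall>X\<in>Obj C. \<exists>!f. f \<in> hom C Z X)"

definition is_coproduct ::
  "('o, 'a, 'z) cat_scheme \<Rightarrow> 'o \<Rightarrow> 'o \<Rightarrow> 'o \<Rightarrow> 'a \<Rightarrow> 'a \<Rightarrow> bool" where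
  "is_coproduct C X Y S j0 j1 \<longleftrightarrow> j0 \<in> hom C X S \<and> j1 \<in> hom C Y S \<and>
    (\<forall>Z a b. a \<in> hom C X Z \<longrightarrow> b \<in> hom C Y Z \<longrightarrow>
       (\<exists>!u. u \<in> hom C S Z \<and> Comp C u j0 = a \<and> Comp C u j1 = b))"


section \<open>Model categories\<close>

definition comm_square :: "('o, 'a, 'z) cat_scheme \<Rightarrow> 'a \<Rightarrow> 'a \<Rightarrow> 'a \<Rightarrow> 'a \<Rightarrow> bool" where
  "comm_square C f g u v \<longleftrightarrow> f \<in> Arr C \<and> g \<in> Arr C \<and>
    u \<in> hom C (Dom C f) (Dom C g) \<and> v \<in> hom C (Cod C f) (Cod C g) \<and>
    Comp C v f = Comp C g u"

definition is_retract :: "('o, 'a, 'z) cat_scheme \<Rightarrow> 'a \<Rightarrow> 'a \<Rightarrow> bool" where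
  "is_retract C f g \<longleftrightarrow> (\<exists>u v u' v'. comm_square C f g u v \<and> comm_square C g f u' v' \<and>
    Comp C u' u = Ident C (Dom C f) \<and> Comp C v' v = Ident C (Cod C f))"

definition has_lift :: "('o, 'a, 'z) cat_scheme \<Rightarrow> 'a \<Rightarrow> 'a \<Rightarrow> bool" where
  "has_lift C i p \<longleftrightarrow> (\<forall>u v. comm_square C i p u v \<longrightarrow>
    (\<exists>h\<in>hom C (Cod C i) (Dom C p). Comp C h i = u \<and> Comp C p h = v))"

text \<open>A functorial factorization sends f to \<open>Dom f \<rightarrow> E f \<rightarrow> Cod f\<close>, with first map \<open>l f\<close> and
  second map \<open>r f\<close>, and a square \<open>(u, v)\<close> from f to g to \<open>m f g u v\<close> from \<open>E f\<close> to \<open>E g\<close>.\<close>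

definition functorial_factorization ::
  "('o, 'a, 'z) cat_scheme \<Rightarrow> 'a set \<Rightarrow> 'a set \<Rightarrow>
   ('a \<Rightarrow> 'a) \<Rightarrow> ('a \<Rightarrow> 'a) \<Rightarrow> ('a \<Rightarrow> 'a \<Rightarrow> 'a \<Rightarrow> 'a \<Rightarrow> 'a) \<Rightarrow> bool" where
  "functorial_factorization C L R l r m \<longleftrightarrow>
    (\<forall>f\<in>Arr C. l f \<in> L \<and> r f \<in> R \<and> l f \<in> Arr C \<and> Dom C (l f) = Dom C f \<and>
       r f \<in> hom C (Cod C (l f)) (Cod C f) \<and> Comp C (r f) (l f) = f) \<and>
    (\<forall>f g u v. comm_square C f g u v \<longrightarrow>
       m f g u v \<in> hom C (Cod C (l f)) (Cod C (l g)) \<and>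
       Comp C (m f g u v) (l f) = Comp C (l g) u \<and>
       Comp C (r g) (m f g u v) = Comp C v (r f)) \<and>
    (\<forall>f\<in>Arr C. m f f (Ident C (Dom C f)) (Ident C (Cod C f)) = Ident C (Cod C (l f))) \<and>
    (\<forall>f g h u v u' v'. comm_square C f g u v \<longrightarrow> comm_square C g h u' v' \<longrightarrow>
       m f h (Comp C u' u) (Comp C v' v) = Comp C (m g h u' v') (m f g u v))"

record ('o, 'a) model_cat = "('o, 'a) cat" +
  Weq :: "'a set"
  Cof :: "'a set"
  Fib :: "'a set"

definition op_model :: "('o, 'a) model_cat \<Rightarrow> ('o, 'a) model_cat" where
  "op_model M = \<lparr>Obj = Obj M, Arr = Arr M, Dom = Cod M, Cod = Dom M,
     Ident = Ident M, Comp = (\<lambda>g f. Comp M f g),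
     Weq = Weq M, Cof = Fib M, Fib = Cof M\<rparr>"

text \<open>Only finite limits and colimits are required, as in the original axioms of Quillen; a model
  category in the sense that asks for all small ones satisfies this as well. That the three
  classes contain the identities and are closed under composition follows from the axioms.\<close>

definition model_category :: "('o, 'a) model_cat \<Rightarrow> bool" where
  "model_category M \<longleftrightarrow> category M \<and> has_finite_limits M \<and> has_finite_colimits M \<and>
    Weq M \<subseteq> Arr M \<and> Cof M \<subseteq> Arr M \<and> Fib M \<subseteq> Arr M \<and>
    (\<forall>X Y Z f g. f \<in> hom M X Y \<longrightarrow> g \<in> hom M Y Z \<longrightarrow>
       (f \<in> Weq M \<longrightarrow> g \<in> Weq M \<longrightarrow> Comp M g f \<in> Weq M) \<and>
       (f \<in> Weq M \<longrightarrow> Comp M g f \<in> Weq M \<longrightarrow> g \<in> Weq M) \<and>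
       (g \<in> Weq M \<longrightarrow> Comp M g f \<in> Weq M \<longrightarrow> f \<in> Weq M)) \<and>
    (\<forall>f g. is_retract M f g \<longrightarrow>
       (g \<in> Weq M \<longrightarrow> f \<in> Weq M) \<and> (g \<in> Cof M \<longrightarrow> f \<in> Cof M) \<and> (g \<in> Fib M \<longrightarrow> f \<in> Fib M)) \<and>
    (\<forall>i\<in>Cof M. \<forall>p\<in>Fib M. i \<in> Weq M \<or> p \<in> Weq M \<longrightarrow> has_lift M i p) \<and>
    (\<exists>l r m. functorial_factorization M (Cof M) (Fib M \<inter> Weq M) l r m) \<and>
    (\<exists>l r m. functorial_factorization M (Cof M \<inter> Weq M) (Fib M) l r m)"

definition cofibrant :: "('o, 'a) model_cat \<Rightarrow> 'o \<Rightarrow> bool" where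
  "cofibrant M X \<longleftrightarrow> (\<exists>Z. is_initial M Z \<and> (\<exists>f\<in>hom M Z X. f \<in> Cof M))"

definition fibrant :: "('o, 'a) model_cat \<Rightarrow> 'o \<Rightarrow> bool" where
  "fibrant M X \<longleftrightarrow> cofibrant (op_model M) X"

definition cofibrant_subcat :: "('o, 'a) model_cat \<Rightarrow> ('o, 'a) cat" where
  "cofibrant_subcat M = full_subcat M {X. cofibrant M X}"


section \<open>Homotopy and the Kan homotopy category\<close>

text \<open>Cylinder object: a factorization of the fold map of X into a cofibration
  \<open>i : X + X \<rightarrow> Q\<close> and a weak equivalence \<open>p : Q \<rightarrow> X\<close>; it is recorded by Q and the two
  components \<open>i0\<close>, \<open>i1\<close> of i.\<close>

definition is_cylinder :: "('o, 'a) model_cat \<Rightarrow> 'o \<Rightarrow> 'o \<Rightarrow> 'a \<Rightarrow> 'a \<Rightarrow> bool" where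
  "is_cylinder M X Q i0 i1 \<longleftrightarrow>
    (\<exists>S j0 j1 i p. is_coproduct M X X S j0 j1 \<and>
       i \<in> hom M S Q \<and> i \<in> Cof M \<and> p \<in> hom M Q X \<and> p \<in> Weq M \<and>
       i0 = Comp M i j0 \<and> i1 = Comp M i j1 \<and>
       Comp M p i0 = Ident M X \<and> Comp M p i1 = Ident M X)"

definition left_homotopic :: "('o, 'a) model_cat \<Rightarrow> 'a \<Rightarrow> 'a \<Rightarrow> bool" where
  "left_homotopic M f g \<longleftrightarrow> f \<in> Arr M \<and> g \<in> hom M (Dom M f) (Cod M f) \<and>
    (\<exists>Q i0 i1. is_cylinder M (Dom M f) Q i0 i1 \<and>
       (\<exists>h\<in>hom M Q (Cod M f). Comp M h i0 = f \<and> Comp M h i1 = g))"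

text \<open>A cylinder object in the opposite model category is a path object.\<close>

definition right_homotopic :: "('o, 'a) model_cat \<Rightarrow> 'a \<Rightarrow> 'a \<Rightarrow> bool" where
  "right_homotopic M f g \<longleftrightarrow> left_homotopic (op_model M) f g"

definition homotopic :: "('o, 'a) model_cat \<Rightarrow> 'a \<Rightarrow> 'a \<Rightarrow> bool" where
  "homotopic M f g \<longleftrightarrow> left_homotopic M f g \<and> right_homotopic M f g"

definition homotopy_class :: "('o, 'a) model_cat \<Rightarrow> 'a \<Rightarrow> 'a set" where
  "homotopy_class M f = {g. homotopic M f g}"

text \<open>Between fibrant-cofibrant objects homotopy is a congruence, so all members of a class have
  the same domain and codomain and the union in the composite is the single class [g f].\<close>

definition HoK :: "('o, 'a) model_cat \<Rightarrow> ('o, 'a set) cat" where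
  "HoK M = \<lparr>Obj = {X \<in> Obj M. cofibrant M X \<and> fibrant M X},
     Arr = {homotopy_class M f | f. f \<in> Arr M \<and>
              cofibrant M (Dom M f) \<and> fibrant M (Dom M f) \<and>
              cofibrant M (Cod M f) \<and> fibrant M (Cod M f)},
     Dom = (\<lambda>c. the_elem (Dom M ` c)),
     Cod = (\<lambda>c. the_elem (Cod M ` c)),
     Ident = (\<lambda>X. homotopy_class M (Ident M X)),
     Comp = (\<lambda>d c. \<Union>g\<in>d. \<Union>f\<in>c. homotopy_class M (Comp M g f))\<rparr>"

text \<open>A choice of replacements: \<open>cmap X\<close> from \<open>CRep X\<close> to X, \<open>fmap X\<close> from X to \<open>FRep X\<close>,
  and lifts \<open>CLift f\<close>, \<open>FLift f\<close> of arrows. The lifts need not be functorial.\<close>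

record ('o, 'a) replacement =
  CRep :: "'o \<Rightarrow> 'o"
  cmap :: "'o \<Rightarrow> 'a"
  CLift :: "'a \<Rightarrow> 'a"
  FRep :: "'o \<Rightarrow> 'o"
  fmap :: "'o \<Rightarrow> 'a"
  FLift :: "'a \<Rightarrow> 'a"

text \<open>That the composite \<open>0 \<rightarrow> CRep X \<rightarrow> X\<close> is the map from the initial object is automatic, so
  the factorization amounts to \<open>CRep X\<close> being cofibrant and \<open>cmap X\<close> being a trivial
  fibration; dually for \<open>FRep X\<close>.\<close>

definition is_replacement :: "('o, 'a) model_cat \<Rightarrow> ('o, 'a) replacement \<Rightarrow> bool" where
  "is_replacement M R \<longleftrightarrow>
    (\<forall>X\<in>Obj M. cofibrant M (CRep R X) \<and>
       cmap R X \<in> hom M (CRep R X) X \<and> cmap R X \<in> Fib M \<inter> Weq M \<and>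
       (cofibrant M X \<longrightarrow> CRep R X = X \<and> cmap R X = Ident M X)) \<and>
    (\<forall>f\<in>Arr M. CLift R f \<in> hom M (CRep R (Dom M f)) (CRep R (Cod M f)) \<and>
       Comp M (cmap R (Cod M f)) (CLift R f) = Comp M f (cmap R (Dom M f))) \<and>
    (\<forall>X\<in>Obj M. fibrant M (FRep R X) \<and>
       fmap R X \<in> hom M X (FRep R X) \<and> fmap R X \<in> Cof M \<inter> Weq M \<and>
       (fibrant M X \<longrightarrow> FRep R X = X \<and> fmap R X = Ident M X)) \<and>
    (\<forall>g\<in>Arr M. FLift R g \<in> hom M (FRep R (Dom M g)) (FRep R (Cod M g)) \<and>
       Comp M (FLift R g) (fmap R (Dom M g)) = Comp M (fmap R (Cod M g)) g)"

definition loc_functor ::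
  "('o, 'a) model_cat \<Rightarrow> ('o, 'a) replacement \<Rightarrow> ('o, 'a, 'o, 'a set) cat_functor" where
  "loc_functor M R = \<lparr>Fob = (\<lambda>X. FRep R (CRep R X)),
     Far = (\<lambda>f. homotopy_class M (FLift R (CLift R f)))\<rparr>"


section \<open>Derived functors\<close>

text \<open>A pair as provided by the faint universal property of L for G, with the structural
  isomorphism written in the direction from \<open>K L\<close> to G.\<close>

definition faint_extension ::
  "('o, 'a, 'x) cat_scheme \<Rightarrow> ('p, 'b, 'y) cat_scheme \<Rightarrow> ('q, 'c, 'z) cat_scheme \<Rightarrow>
   ('o, 'a, 'p, 'b) cat_functor \<Rightarrow> ('o, 'a, 'q, 'c) cat_functor \<Rightarrow>
   ('p, 'b, 'q, 'c) cat_functor \<Rightarrow> ('o \<Rightarrow> 'c) \<Rightarrow> bool" where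
  "faint_extension C C' D L G K \<iota> \<longleftrightarrow> is_functor C' D K \<and> nat_iso C D (fcomp K L) G \<iota>"

definition F_derived_functor ::
  "('o, 'a) model_cat \<Rightarrow> ('p, 'b) model_cat \<Rightarrow> ('o, 'a) replacement \<Rightarrow> ('p, 'b) replacement \<Rightarrow>
   ('o, 'a, 'p, 'b) cat_functor \<Rightarrow> ('o, 'a set, 'p, 'b set) cat_functor \<Rightarrow> ('o \<Rightarrow> 'b set) \<Rightarrow> bool" where
  "F_derived_functor M N R S F K \<iota> \<longleftrightarrow>
    faint_extension (cofibrant_subcat M) (HoK M) (HoK N)
      (fcomp (loc_functor M R) inclusion)
      (fcomp (loc_functor N S) (fcomp F inclusion)) K \<iota>"

definition Kan_derived_functor ::
  "('o, 'a) model_cat \<Rightarrow> ('p, 'b) model_cat \<Rightarrow> ('o, 'a) replacement \<Rightarrow> ('p, 'b) replacement \<Rightarrow>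
   ('o, 'a, 'p, 'b) cat_functor \<Rightarrow> ('o, 'a set, 'p, 'b set) cat_functor \<Rightarrow> ('o \<Rightarrow> 'b set) \<Rightarrow> bool" where
  "Kan_derived_functor M N R S F K \<epsilon> \<longleftrightarrow>
    right_Kan_extension (cofibrant_subcat M) (HoK M) (HoK N)
      (fcomp (loc_functor M R) inclusion)
      (fcomp (loc_functor N S) (fcomp F inclusion)) K \<epsilon>"

end

theory Submission
  imports Defs
begin

text \<open>Write \<open>L\<close> for the localization of the cofibrant objects and \<open>G\<close> for the functor to be derived,
  which inverts weak equivalences. A faint extension is a functor \<open>K\<close> with an isomorphism
  \<open>\<iota> : K L \<cong> G\<close>, and \<open>(K, \<iota>)\<close> is a right Kan extension for the following reason. The objects of the
  homotopy category are the bifibrant objects of the model category itself, and on them \<open>L\<close> is the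
  identity on objects and sends \<open>f\<close> to its class \<open>[f]\<close>. So a transformation \<open>\<theta> : H \<Rightarrow> K\<close> that
  factors a given \<open>\<zeta> : H L \<Rightarrow> G\<close> must be the inverse of \<open>\<iota>\<close> after \<open>\<zeta>\<close> at bifibrant objects, and
  this is natural because every arrow of the homotopy category is a class \<open>[f]\<close>. What remains is the
  equation \<open>\<iota> (\<theta> L) = \<zeta>\<close> at a cofibrant \<open>X\<close> that is not fibrant. The fibrant replacement map
  \<open>r : X \<rightarrow> X'\<close> becomes an identity under \<open>L\<close>, so by naturality along it the components of \<open>\<iota>\<close> and \<open>\<zeta>\<close>
  at \<open>X'\<close> are those at \<open>X\<close> followed by the isomorphism \<open>G r\<close>, and the equation at \<open>X'\<close> carries over
  to \<open>X\<close>. The locale \<open>sectioned_functor\<close> isolates the properties of \<open>L\<close> that enter;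
  \<open>faint_extension_is_Kan_extension\<close> is this argument.

  The extension itself exists (\<open>faint_extension_exists\<close>) with \<open>K X = G X\<close> and \<open>K [f] = G f\<close>,
  with the inverse of \<open>G r\<close> as structural isomorphism, once \<open>G\<close> identifies homotopic
  maps. It does, since the two ends of a cylinder have a common weak equivalence as retraction.

  The rest is the theory of the homotopy category that makes \<open>L\<close> and \<open>G\<close> functors with these
  properties: homotopy is a congruence on bifibrant objects, lifts and extensions of maps to
  replacements are unique up to homotopy (\<open>localization_functor\<close>), and weak equivalences become
  isomorphisms (\<open>weq_class_iso\<close>, Whitehead's theorem). That homotopy is an equivalence relation, the
  same from the left as from the right, comes from one lifting argument, \<open>homotopy_transport\<close>, and
  from duality, \<open>model_op\<close>.\<close>


section \<open>Elementary category theory\<close>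

lemma homD:
  assumes "category C" and "f \<in> hom C X Y"
  shows "f \<in> Arr C" "Dom C f = X" "Cod C f = Y" "X \<in> Obj C" "Y \<in> Obj C"
  using assms unfolding category_def hom_def by auto

lemma arr_hom: "f \<in> Arr C \<Longrightarrow> f \<in> hom C (Dom C f) (Cod C f)"
  by (simp add: hom_def)

lemma id_hom: "category C \<Longrightarrow> X \<in> Obj C \<Longrightarrow> Ident C X \<in> hom C X X"
  unfolding category_def by blast

lemma comp_hom: "category C \<Longrightarrow> f \<in> hom C X Y \<Longrightarrow> g \<in> hom C Y Z \<Longrightarrow> Comp C g f \<in> hom C X Z"
  unfolding category_def by blast

lemma id_right: "category C \<Longrightarrow> f \<in> hom C X Y \<Longrightarrow> Comp C f (Ident C X) = f"
  unfolding category_def by blast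

lemma id_left: "category C \<Longrightarrow> f \<in> hom C X Y \<Longrightarrow> Comp C (Ident C Y) f = f"
  unfolding category_def by blast

lemma comp_assoc:
  "category C \<Longrightarrow> f \<in> hom C W X \<Longrightarrow> g \<in> hom C X Y \<Longrightarrow> h \<in> hom C Y Z \<Longrightarrow>
    Comp C h (Comp C g f) = Comp C (Comp C h g) f"
  unfolding category_def by blast

lemma categoryI:
  assumes "\<And>f. f \<in> Arr C \<Longrightarrow> Dom C f \<in> Obj C" "\<And>f. f \<in> Arr C \<Longrightarrow> Cod C f \<in> Obj C"
    and "\<And>X. X \<in> Obj C \<Longrightarrow> Ident C X \<in> hom C X X"
    and "\<And>X Y Z f g. f \<in> hom C X Y \<Longrightarrow> g \<in> hom C Y Z \<Longrightarrow> Comp C g f \<in> hom C X Z"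
    and "\<And>X Y f. f \<in> hom C X Y \<Longrightarrow> Comp C f (Ident C X) = f"
    and "\<And>X Y f. f \<in> hom C X Y \<Longrightarrow> Comp C (Ident C Y) f = f"
    and "\<And>W X Y Z f g h. f \<in> hom C W X \<Longrightarrow> g \<in> hom C X Y \<Longrightarrow> h \<in> hom C Y Z \<Longrightarrow>
       Comp C h (Comp C g f) = Comp C (Comp C h g) f"
  shows "category C"
  unfolding category_def
  by (intro conjI ballI allI impI) (rule assms(1-4); assumption | rule assms(5-7), assumption+)+

lemma is_isoE:
  assumes "category C" and "is_iso C f" and "f \<in> hom C X Y"
  obtains g where "g \<in> hom C Y X" "Comp C g f = Ident C X" "Comp C f g = Ident C Y"
  using assms homD[OF assms(1,3)] unfolding is_iso_def by auto

lemma is_isoI: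
  assumes "f \<in> hom C X Y" "g \<in> hom C Y X" "Comp C g f = Ident C X" "Comp C f g = Ident C Y"
  shows "is_iso C f"
  using assms unfolding is_iso_def hom_def by auto

lemma iso_cancel_left:
  assumes C: "category C" and i: "is_iso C p" "p \<in> hom C Y Z"
    and f: "f \<in> hom C X Y" "g \<in> hom C X Y" and eq: "Comp C p f = Comp C p g"
  shows "f = g"
proof -
  obtain q where q: "q \<in> hom C Z Y" "Comp C q p = Ident C Y"
    using is_isoE[OF C i] by metis
  have "f = Comp C q (Comp C p f)"
    using comp_assoc[OF C f(1) i(2) q(1)] q(2) id_left[OF C f(1)] by simp
  also have "\<dots> = g"
    using comp_assoc[OF C f(2) i(2) q(1)] q(2) id_left[OF C f(2)] eq by simp
  finally show ?thesis .
qed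

lemma functor_cat: "is_functor C D F \<Longrightarrow> category C" "is_functor C D F \<Longrightarrow> category D"
  unfolding is_functor_def by auto

lemma functor_obj: "is_functor C D F \<Longrightarrow> X \<in> Obj C \<Longrightarrow> Fob F X \<in> Obj D"
  unfolding is_functor_def by blast

lemma functor_hom:
  "is_functor C D F \<Longrightarrow> f \<in> hom C X Y \<Longrightarrow> Far F f \<in> hom D (Fob F X) (Fob F Y)"
  unfolding is_functor_def hom_def by auto

lemma functor_id: "is_functor C D F \<Longrightarrow> X \<in> Obj C \<Longrightarrow> Far F (Ident C X) = Ident D (Fob F X)"
  unfolding is_functor_def by blast

lemma functor_comp:
  "is_functor C D F \<Longrightarrow> f \<in> hom C X Y \<Longrightarrow> g \<in> hom C Y Z \<Longrightarrow>
    Far F (Comp C g f) = Comp D (Far F g) (Far F f)"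
  unfolding is_functor_def by blast

lemma is_functorI:
  assumes "category C" "category D"
    and "\<And>X. X \<in> Obj C \<Longrightarrow> Fob F X \<in> Obj D"
    and "\<And>X Y f. f \<in> hom C X Y \<Longrightarrow> Far F f \<in> hom D (Fob F X) (Fob F Y)"
    and "\<And>X. X \<in> Obj C \<Longrightarrow> Far F (Ident C X) = Ident D (Fob F X)"
    and "\<And>X Y Z f g. f \<in> hom C X Y \<Longrightarrow> g \<in> hom C Y Z \<Longrightarrow>
       Far F (Comp C g f) = Comp D (Far F g) (Far F f)"
  shows "is_functor C D F"
  unfolding is_functor_def using assms(1-3,5,6) assms(4)[OF arr_hom] by simp

lemma fcomp_sel [simp]:
  "Fob (fcomp G F) X = Fob G (Fob F X)" "Far (fcomp G F) f = Far G (Far F f)"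
  "Fob inclusion Y = Y" "Far inclusion g = g"
  by (simp_all add: fcomp_def inclusion_def)

lemma functor_fcomp:
  assumes F: "is_functor C D F" and G: "is_functor D E G"
  shows "is_functor C E (fcomp G F)"
proof (rule is_functorI[OF functor_cat(1)[OF F] functor_cat(2)[OF G]])
  fix X Y Z f g assume "f \<in> hom C X Y" and "g \<in> hom C Y Z"
  then show "Far (fcomp G F) (Comp C g f) = Comp E (Far (fcomp G F) g) (Far (fcomp G F) f)"
    by (simp add: functor_comp[OF F] functor_comp[OF G functor_hom[OF F] functor_hom[OF F]])
qed (simp_all add: functor_obj[OF F] functor_obj[OF G] functor_id[OF F] functor_id[OF G]
      functor_hom[OF G functor_hom[OF F]])

lemma full_subcat_hom:
  "f \<in> hom (full_subcat C S) X Y \<longleftrightarrow> f \<in> hom C X Y \<and> X \<in> S \<and> Y \<in> S"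
  unfolding hom_def full_subcat_def by auto

lemma full_subcat_sel [simp]:
  "Obj (full_subcat C S) = Obj C \<inter> S" "Ident (full_subcat C S) = Ident C"
  "Comp (full_subcat C S) = Comp C"
  by (simp_all add: full_subcat_def)

lemma full_subcat_category:
  assumes "category C"
  shows "category (full_subcat C S)"
proof (rule categoryI)
  fix f X Y assume f: "f \<in> hom (full_subcat C S) X Y"
  then show "Comp (full_subcat C S) f (Ident (full_subcat C S) X) = f"
    and "Comp (full_subcat C S) (Ident (full_subcat C S) Y) f = f"
    using id_left[OF assms] id_right[OF assms] by (auto simp: full_subcat_hom)
next
  fix f g h W X Y Z
  assume "f \<in> hom (full_subcat C S) W X" "g \<in> hom (full_subcat C S) X Y"
    "h \<in> hom (full_subcat C S) Y Z"
  then show "Comp (full_subcat C S) h (Comp (full_subcat C S) g f) =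
      Comp (full_subcat C S) (Comp (full_subcat C S) h g) f"
    using comp_assoc[OF assms] by (metis full_subcat_hom full_subcat_sel(3))
next
  fix f assume "f \<in> Arr (full_subcat C S)"
  then show "Dom (full_subcat C S) f \<in> Obj (full_subcat C S)"
    and "Cod (full_subcat C S) f \<in> Obj (full_subcat C S)"
    using assms unfolding full_subcat_def category_def by auto
qed (use id_hom[OF assms] comp_hom[OF assms] in \<open>auto simp: full_subcat_hom\<close>)

lemma inclusion_functor:
  assumes "category C"
  shows "is_functor (full_subcat C S) C inclusion"
  by (rule is_functorI) (auto simp: full_subcat_category assms full_subcat_hom)

lemma nat_transD:
  assumes "nat_trans C D F G \<tau>"
  shows "X \<in> Obj C \<Longrightarrow> \<tau> X \<in> hom D (Fob F X) (Fob G X)"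
    and "f \<in> hom C X Y \<Longrightarrow> Comp D (\<tau> Y) (Far F f) = Comp D (Far G f) (\<tau> X)"
  using assms unfolding nat_trans_def hom_def by auto

lemma nat_transI:
  assumes "is_functor C D F" "is_functor C D G" "\<tau> \<in> extensional (Obj C)"
    and "\<And>X. X \<in> Obj C \<Longrightarrow> \<tau> X \<in> hom D (Fob F X) (Fob G X)"
    and "\<And>X Y f. f \<in> hom C X Y \<Longrightarrow> Comp D (\<tau> Y) (Far F f) = Comp D (Far G f) (\<tau> X)"
  shows "nat_trans C D F G \<tau>"
  unfolding nat_trans_def using assms(1-4) assms(5)[OF arr_hom] by simp


section \<open>Kan extensions along functors with an objectwise section\<close>

text \<open>The data under which a faint extension is a Kan extension. The section \<open>\<sigma>\<close> acts on objects
  only; \<open>r\<close> plays the part of the unit of a reflection onto its image, but it is natural only for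
  some choice of the comparison arrow over a given arrow of \<open>C'\<close>. Fibrant replacement has just
  this form, since its action on arrows is well defined only up to homotopy.\<close>

locale sectioned_functor =
  fixes C :: "('o, 'a, 'x) cat_scheme" and C' :: "('p, 'b, 'y) cat_scheme"
    and P :: "('o, 'a, 'p, 'b) cat_functor" and \<sigma> :: "'p \<Rightarrow> 'o" and r :: "'o \<Rightarrow> 'a"
  assumes P: "is_functor C C' P"
    and \<sigma>_obj: "Y \<in> Obj C' \<Longrightarrow> \<sigma> Y \<in> Obj C"
    and P_\<sigma>: "Y \<in> Obj C' \<Longrightarrow> Fob P (\<sigma> Y) = Y"
    and full: "c \<in> hom C' Y Y' \<Longrightarrow> \<exists>f\<in>hom C (\<sigma> Y) (\<sigma> Y'). Far P f = c"
    and r_hom: "X \<in> Obj C \<Longrightarrow> r X \<in> hom C X (\<sigma> (Fob P X))"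
    and P_r: "X \<in> Obj C \<Longrightarrow> Far P (r X) = Ident C' (Fob P X)"
    and r_nat: "a \<in> hom C X X' \<Longrightarrow> \<exists>b\<in>hom C (\<sigma> (Fob P X)) (\<sigma> (Fob P X')).
      Far P b = Far P a \<and> Comp C b (r X) = Comp C (r X') a"
begin

text \<open>Because \<open>P\<close> sends \<open>r X\<close> to an identity, naturality at \<open>r X\<close> expresses the component of a
  transformation \<open>H P \<Rightarrow> G\<close> at \<open>\<sigma> (P X)\<close> by the one at \<open>X\<close>.\<close>

lemma transformation_at_section:
  assumes H: "is_functor C' D H" and \<zeta>: "nat_trans C D (fcomp H P) G \<zeta>" and X: "X \<in> Obj C"
  shows "\<zeta> (\<sigma> (Fob P X)) = Comp D (Far G (r X)) (\<zeta> X)"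
proof -
  have PX: "Fob P X \<in> Obj C'" by (rule functor_obj[OF P X])
  have "\<zeta> (\<sigma> (Fob P X)) \<in> hom D (Fob H (Fob P X)) (Fob G (\<sigma> (Fob P X)))"
    using nat_transD(1)[OF \<zeta> \<sigma>_obj[OF PX]] P_\<sigma>[OF PX] by simp
  then have "\<zeta> (\<sigma> (Fob P X)) = Comp D (\<zeta> (\<sigma> (Fob P X))) (Far (fcomp H P) (r X))"
    using id_right[OF functor_cat(2)[OF H]] by (simp add: P_r[OF X] functor_id[OF H PX])
  also have "\<dots> = Comp D (Far G (r X)) (\<zeta> X)"
    by (rule nat_transD(2)[OF \<zeta> r_hom[OF X]])
  finally show ?thesis .
qed

text \<open>On the image of \<open>\<sigma>\<close>, which meets every object of \<open>C'\<close>, the equation that determines \<open>\<theta>\<close>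
  reads \<open>\<iota> \<theta> = \<zeta>\<close>, so invertibility of \<open>\<iota>\<close> yields both uniqueness and the formula for \<open>\<theta>\<close>.
  The previous lemma, for \<open>\<iota>\<close> and for \<open>\<zeta>\<close>, carries the equation to all objects of \<open>C\<close>.\<close>

theorem faint_extension_is_Kan_extension:
  assumes fe: "faint_extension C C' D P G K \<iota>"
  shows "right_Kan_extension C C' D P G K \<iota>"
proof -
  have K: "is_functor C' D K" and \<iota>: "nat_trans C D (fcomp K P) G \<iota>"
    and iso: "\<And>X. X \<in> Obj C \<Longrightarrow> is_iso D (\<iota> X)"
    using fe unfolding faint_extension_def nat_iso_def by auto
  have D: "category D" by (rule functor_cat(2)[OF K])
  have G: "is_functor C D G" using \<iota> unfolding nat_trans_def by blast
  have \<iota>_hom: "\<iota> X \<in> hom D (Fob K (Fob P X)) (Fob G X)" if "X \<in> Obj C" for X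
    using nat_transD(1)[OF \<iota> that] by simp
  have "\<exists>!\<theta>. nat_trans C' D H K \<theta> \<and> vcomp C D \<iota> (whisker C \<theta> P) = \<zeta>"
    if H: "is_functor C' D H" and \<zeta>: "nat_trans C D (fcomp H P) G \<zeta>" for H \<zeta>
  proof -
    have \<zeta>_hom: "\<zeta> X \<in> hom D (Fob H (Fob P X)) (Fob G X)" if "X \<in> Obj C" for X
      using nat_transD(1)[OF \<zeta> that] by simp
    have ex: "\<exists>t\<in>hom D (Fob H Y) (Fob K Y). Comp D (\<iota> (\<sigma> Y)) t = \<zeta> (\<sigma> Y)"
      if Y: "Y \<in> Obj C'" for Y
    proof -
      have i: "\<iota> (\<sigma> Y) \<in> hom D (Fob K Y) (Fob G (\<sigma> Y))"
        and z: "\<zeta> (\<sigma> Y) \<in> hom D (Fob H Y) (Fob G (\<sigma> Y))"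
        using \<iota>_hom[OF \<sigma>_obj[OF Y]] \<zeta>_hom[OF \<sigma>_obj[OF Y]] P_\<sigma>[OF Y] by simp_all
      obtain j where j: "j \<in> hom D (Fob G (\<sigma> Y)) (Fob K Y)"
        "Comp D (\<iota> (\<sigma> Y)) j = Ident D (Fob G (\<sigma> Y))"
        using is_isoE[OF D iso[OF \<sigma>_obj[OF Y]] i] by metis
      show ?thesis
        using comp_hom[OF D z j(1)] comp_assoc[OF D z j(1) i] j(2) id_left[OF D z] by metis
    qed
    \<comment> \<open>Defined by choice; the choice is unique because \<open>\<iota> (\<sigma> Y)\<close> is invertible.\<close>
    define \<theta> where "\<theta> = restrict (\<lambda>Y. SOME t. t \<in> hom D (Fob H Y) (Fob K Y) \<and>
      Comp D (\<iota> (\<sigma> Y)) t = \<zeta> (\<sigma> Y)) (Obj C')"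
    have \<theta>: "\<theta> Y \<in> hom D (Fob H Y) (Fob K Y)" "Comp D (\<iota> (\<sigma> Y)) (\<theta> Y) = \<zeta> (\<sigma> Y)"
      if "Y \<in> Obj C'" for Y
      using someI_ex[of "\<lambda>t. t \<in> hom D (Fob H Y) (Fob K Y) \<and>
        Comp D (\<iota> (\<sigma> Y)) t = \<zeta> (\<sigma> Y)"] ex[OF that] that by (auto simp: \<theta>_def)
    have eq: "Comp D (\<iota> X) (\<theta> (Fob P X)) = \<zeta> X" if X: "X \<in> Obj C" for X
    proof -
      have PX: "Fob P X \<in> Obj C'" by (rule functor_obj[OF P X])
      let ?Z = "\<sigma> (Fob P X)"
      have Z: "?Z \<in> Obj C" by (rule \<sigma>_obj[OF PX])
      have Gr: "Far G (r X) \<in> hom D (Fob G X) (Fob G ?Z)" by (rule functor_hom[OF G r_hom[OF X]])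
      have i: "\<iota> ?Z = Comp D (Far G (r X)) (\<iota> X)" by (rule transformation_at_section[OF K \<iota> X])
      have z: "\<zeta> ?Z = Comp D (Far G (r X)) (\<zeta> X)" by (rule transformation_at_section[OF H \<zeta> X])
      obtain a where a: "a \<in> hom D (Fob G X) (Fob K (Fob P X))"
        "Comp D (\<iota> X) a = Ident D (Fob G X)"
        using is_isoE[OF D iso[OF X] \<iota>_hom[OF X]] by metis
      have t: "\<theta> (Fob P X) \<in> hom D (Fob H (Fob P X)) (Fob K (Fob P X))" by (rule \<theta>(1)[OF PX])
      \<comment> \<open>The only arrow that can solve the equation at \<open>X\<close> also solves the one at the section,
        hence equals \<open>\<theta>\<close> there.\<close>
      define b where "b = Comp D a (\<zeta> X)"
      have b: "b \<in> hom D (Fob H (Fob P X)) (Fob K (Fob P X))"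
        unfolding b_def by (rule comp_hom[OF D \<zeta>_hom[OF X] a(1)])
      have ib: "Comp D (\<iota> X) b = \<zeta> X"
        unfolding b_def using comp_assoc[OF D \<zeta>_hom[OF X] a(1) \<iota>_hom[OF X]] a(2)
          id_left[OF D \<zeta>_hom[OF X]] by simp
      have iZ: "\<iota> ?Z \<in> hom D (Fob K (Fob P X)) (Fob G ?Z)"
        using \<iota>_hom[OF Z] P_\<sigma>[OF PX] by simp
      have "Comp D (\<iota> ?Z) b = \<zeta> ?Z"
        using comp_assoc[OF D b \<iota>_hom[OF X] Gr] i z ib by simp
      then have "\<theta> (Fob P X) = b"
        using iso_cancel_left[OF D iso[OF Z] iZ t b] \<theta>(2)[OF PX] by simp
      then show ?thesis using ib by simp
    qed
    have nat: "nat_trans C' D H K \<theta>"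
    proof (rule nat_transI[OF H K])
      show "\<theta> \<in> extensional (Obj C')" by (simp add: \<theta>_def)
      fix Y Y' c assume c: "c \<in> hom C' Y Y'"
      have Y: "Y \<in> Obj C'" "Y' \<in> Obj C'" using homD[OF functor_cat(2)[OF P] c] by auto
      obtain f where f: "f \<in> hom C (\<sigma> Y) (\<sigma> Y')" "Far P f = c" using full[OF c] by blast
      have Hc: "Far H c \<in> hom D (Fob H Y) (Fob H Y')" and Kc: "Far K c \<in> hom D (Fob K Y) (Fob K Y')"
        by (rule functor_hom[OF H c], rule functor_hom[OF K c])
      have i: "\<iota> (\<sigma> Y) \<in> hom D (Fob K Y) (Fob G (\<sigma> Y))"
        "\<iota> (\<sigma> Y') \<in> hom D (Fob K Y') (Fob G (\<sigma> Y'))"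
        using \<iota>_hom[OF \<sigma>_obj] P_\<sigma> Y by fastforce+
      have Gf: "Far G f \<in> hom D (Fob G (\<sigma> Y)) (Fob G (\<sigma> Y'))" by (rule functor_hom[OF G f(1)])
      have n1: "Comp D (\<iota> (\<sigma> Y')) (Far K c) = Comp D (Far G f) (\<iota> (\<sigma> Y))"
        using nat_transD(2)[OF \<iota> f(1)] f(2) by simp
      have n2: "Comp D (\<zeta> (\<sigma> Y')) (Far H c) = Comp D (Far G f) (\<zeta> (\<sigma> Y))"
        using nat_transD(2)[OF \<zeta> f(1)] f(2) by simp
      have "Comp D (\<iota> (\<sigma> Y')) (Comp D (\<theta> Y') (Far H c)) = Comp D (\<zeta> (\<sigma> Y')) (Far H c)"
        using comp_assoc[OF D Hc \<theta>(1)[OF Y(2)] i(2)] \<theta>(2)[OF Y(2)] by simp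
      also have "\<dots> = Comp D (Comp D (Far G f) (\<iota> (\<sigma> Y))) (\<theta> Y)"
        using comp_assoc[OF D \<theta>(1)[OF Y(1)] i(1) Gf] \<theta>(2)[OF Y(1)] n2 by simp
      also have "\<dots> = Comp D (\<iota> (\<sigma> Y')) (Comp D (Far K c) (\<theta> Y))"
        using comp_assoc[OF D \<theta>(1)[OF Y(1)] Kc i(2)] n1 by simp
      finally show "Comp D (\<theta> Y') (Far H c) = Comp D (Far K c) (\<theta> Y)"
        by (rule iso_cancel_left[OF D iso[OF \<sigma>_obj[OF Y(2)]] i(2)
              comp_hom[OF D Hc \<theta>(1)[OF Y(2)]] comp_hom[OF D \<theta>(1)[OF Y(1)] Kc]])
    qed (rule \<theta>(1))
    have fact: "vcomp C D \<iota> (whisker C \<theta> P) = \<zeta>"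
    proof (rule extensionalityI[where A = "Obj C"])
      show "\<zeta> \<in> extensional (Obj C)" using \<zeta> unfolding nat_trans_def by blast
    qed (auto simp: vcomp_def whisker_def eq)
    show ?thesis
    proof (rule ex1I[where a = \<theta>])
      fix \<theta>' assume \<theta>': "nat_trans C' D H K \<theta>' \<and> vcomp C D \<iota> (whisker C \<theta>' P) = \<zeta>"
      show "\<theta>' = \<theta>"
      proof (rule extensionalityI[where A = "Obj C'"])
        show "\<theta>' \<in> extensional (Obj C')" using \<theta>' unfolding nat_trans_def by blast
        show "\<theta> \<in> extensional (Obj C')" by (simp add: \<theta>_def)
        fix Y assume Y: "Y \<in> Obj C'"
        have "vcomp C D \<iota> (whisker C \<theta>' P) (\<sigma> Y) = \<zeta> (\<sigma> Y)" using \<theta>' by simp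
        then have "Comp D (\<iota> (\<sigma> Y)) (\<theta>' Y) = Comp D (\<iota> (\<sigma> Y)) (\<theta> Y)"
          using \<sigma>_obj[OF Y] P_\<sigma>[OF Y] \<theta>(2)[OF Y] by (simp add: vcomp_def whisker_def)
        moreover have "\<iota> (\<sigma> Y) \<in> hom D (Fob K Y) (Fob G (\<sigma> Y))"
          using \<iota>_hom[OF \<sigma>_obj[OF Y]] P_\<sigma>[OF Y] by simp
        moreover have "\<theta>' Y \<in> hom D (Fob H Y) (Fob K Y)" using nat_transD(1)[OF conjunct1[OF \<theta>'] Y] .
        ultimately show "\<theta>' Y = \<theta> Y"
          using iso_cancel_left[OF D iso[OF \<sigma>_obj[OF Y]]] \<theta>(1)[OF Y] by blast
      qed
    qed (use nat fact in blast)
  qed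
  then show ?thesis unfolding right_Kan_extension_def using P G K \<iota> by blast
qed

text \<open>The extension is \<open>G \<sigma>\<close>, with any arrow over \<open>c\<close> used to compute its value on \<open>c\<close>, and the
  structural isomorphism is the inverse of \<open>G r\<close>.\<close>

theorem faint_extension_exists:
  assumes G: "is_functor C D G"
    and wd: "\<And>Y Y' f g. Y \<in> Obj C' \<Longrightarrow> Y' \<in> Obj C' \<Longrightarrow> f \<in> hom C (\<sigma> Y) (\<sigma> Y') \<Longrightarrow>
      g \<in> hom C (\<sigma> Y) (\<sigma> Y') \<Longrightarrow> Far P f = Far P g \<Longrightarrow> Far G f = Far G g"
    and inv: "\<And>X. X \<in> Obj C \<Longrightarrow> is_iso D (Far G (r X))"
  shows "\<exists>K \<iota>. faint_extension C C' D P G K \<iota>"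
proof -
  note C = functor_cat(1)[OF P] and C' = functor_cat(2)[OF P] and D = functor_cat(2)[OF G]
  define K where "K = \<lparr>Fob = \<lambda>Y. Fob G (\<sigma> Y), Far = \<lambda>c. Far G (SOME f.
    f \<in> hom C (\<sigma> (Dom C' c)) (\<sigma> (Cod C' c)) \<and> Far P f = c)\<rparr>"
  have Kob: "Fob K Y = Fob G (\<sigma> Y)" for Y by (simp add: K_def)
  have P_hom: "Far P f \<in> hom C' Y Y'"
    if "Y \<in> Obj C'" "Y' \<in> Obj C'" "f \<in> hom C (\<sigma> Y) (\<sigma> Y')" for f Y Y'
    using functor_hom[OF P that(3)] P_\<sigma> that by simp
  have Kar: "Far K (Far P f) = Far G f"
    if Y: "Y \<in> Obj C'" "Y' \<in> Obj C'" and f: "f \<in> hom C (\<sigma> Y) (\<sigma> Y')" for f Y Y'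
  proof -
    define g where "g = (SOME g. g \<in> hom C (\<sigma> Y) (\<sigma> Y') \<and> Far P g = Far P f)"
    have "g \<in> hom C (\<sigma> Y) (\<sigma> Y') \<and> Far P g = Far P f"
      unfolding g_def by (rule someI[where x = f]) (simp add: f)
    then have "Far G g = Far G f" using wd[OF Y] f by blast
    then show ?thesis using homD[OF C' P_hom[OF Y f]] by (simp add: K_def g_def)
  qed
  have K: "is_functor C' D K"
  proof (rule is_functorI[OF C' D])
    fix Y assume Y: "Y \<in> Obj C'"
    show "Fob K Y \<in> Obj D" using functor_obj[OF G \<sigma>_obj[OF Y]] by (simp add: Kob)
    show "Far K (Ident C' Y) = Ident D (Fob K Y)"
      using Kar[OF Y Y id_hom[OF C \<sigma>_obj[OF Y]]]
      by (simp add: Kob functor_id[OF P \<sigma>_obj[OF Y]] functor_id[OF G \<sigma>_obj[OF Y]] P_\<sigma>[OF Y])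
  next
    fix X Y c assume c: "c \<in> hom C' X Y"
    note Y = homD(4,5)[OF C' c]
    obtain f where f: "f \<in> hom C (\<sigma> X) (\<sigma> Y)" "Far P f = c" using full[OF c] by blast
    show "Far K c \<in> hom D (Fob K X) (Fob K Y)"
      using functor_hom[OF G f(1)] Kar[OF Y f(1)] f(2) by (simp add: Kob)
    fix Z d assume d: "d \<in> hom C' Y Z"
    note Z = homD(5)[OF C' d]
    obtain g where g: "g \<in> hom C (\<sigma> Y) (\<sigma> Z)" "Far P g = d" using full[OF d] by blast
    show "Far K (Comp C' d c) = Comp D (Far K d) (Far K c)"
      using Kar[OF Y(1) Z comp_hom[OF C f(1) g(1)]] Kar[OF Y f(1)] Kar[OF Y(2) Z g(1)]
      by (simp add: functor_comp[OF P f(1) g(1)] functor_comp[OF G f(1) g(1)] f(2) g(2))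
  qed
  have Gr: "Far G (r X) \<in> hom D (Fob G X) (Fob K (Fob P X))" if "X \<in> Obj C" for X
    using functor_hom[OF G r_hom[OF that]] by (simp add: Kob)
  define \<iota> where "\<iota> = restrict (\<lambda>X. SOME j. j \<in> hom D (Fob K (Fob P X)) (Fob G X) \<and>
    Comp D j (Far G (r X)) = Ident D (Fob G X) \<and>
    Comp D (Far G (r X)) j = Ident D (Fob K (Fob P X))) (Obj C)"
  have \<iota>: "\<iota> X \<in> hom D (Fob K (Fob P X)) (Fob G X) \<and>
      Comp D (\<iota> X) (Far G (r X)) = Ident D (Fob G X) \<and>
      Comp D (Far G (r X)) (\<iota> X) = Ident D (Fob K (Fob P X))" if X: "X \<in> Obj C" for X
  proof -
    obtain j where "j \<in> hom D (Fob K (Fob P X)) (Fob G X) \<and>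
      Comp D j (Far G (r X)) = Ident D (Fob G X) \<and>
      Comp D (Far G (r X)) j = Ident D (Fob K (Fob P X))"
      using is_isoE[OF D inv[OF X] Gr[OF X]] by metis
    then show ?thesis unfolding \<iota>_def restrict_apply'[OF X] by (rule someI)
  qed
  have "nat_iso C D (fcomp K P) G \<iota>"
    unfolding nat_iso_def
  proof (intro conjI ballI)
    fix X assume X: "X \<in> Obj C"
    show "is_iso D (\<iota> X)" using \<iota>[OF X] is_isoI Gr[OF X] by metis
  next
    show "nat_trans C D (fcomp K P) G \<iota>"
    proof (rule nat_transI[OF functor_fcomp[OF P K] G])
      show "\<iota> \<in> extensional (Obj C)" by (simp add: \<iota>_def)
      fix X assume "X \<in> Obj C"
      then show "\<iota> X \<in> hom D (Fob (fcomp K P) X) (Fob G X)" using \<iota> by simp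
    next
      fix X Y a assume a: "a \<in> hom C X Y"
      note X = homD(4)[OF C a] and Y = homD(5)[OF C a]
      obtain b where b: "b \<in> hom C (\<sigma> (Fob P X)) (\<sigma> (Fob P Y))" "Far P b = Far P a"
        "Comp C b (r X) = Comp C (r Y) a" using r_nat[OF a] by blast
      have Gb: "Far G b \<in> hom D (Fob K (Fob P X)) (Fob K (Fob P Y))"
        using functor_hom[OF G b(1)] by (simp add: Kob)
      have Ga: "Far G a \<in> hom D (Fob G X) (Fob G Y)" by (rule functor_hom[OF G a])
      have Ka: "Far K (Far P a) = Far G b"
        using Kar[OF functor_obj[OF P X] functor_obj[OF P Y] b(1)] b(2) by simp
      have sq: "Comp D (Far G b) (Far G (r X)) = Comp D (Far G (r Y)) (Far G a)"
        using b(3) functor_comp[OF G r_hom[OF X] b(1)] functor_comp[OF G a r_hom[OF Y]] by simp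
      note iX = \<iota>[OF X, THEN conjunct1] and iY = \<iota>[OF Y, THEN conjunct1]
      have "Comp D (Far G (r Y)) (Comp D (Far G a) (\<iota> X)) =
          Comp D (Comp D (Far G b) (Far G (r X))) (\<iota> X)"
        using comp_assoc[OF D iX Ga Gr[OF Y]] sq by simp
      also have "\<dots> = Far G b"
        using comp_assoc[OF D iX Gr[OF X] Gb] \<iota>[OF X] id_right[OF D Gb] by simp
      also have "\<dots> = Comp D (Far G (r Y)) (Comp D (\<iota> Y) (Far G b))"
        using comp_assoc[OF D Gb iY Gr[OF Y]] \<iota>[OF Y] id_left[OF D Gb] by simp
      finally have "Comp D (Far G a) (\<iota> X) = Comp D (\<iota> Y) (Far G b)"
        by (rule iso_cancel_left[OF D inv[OF Y] Gr[OF Y] comp_hom[OF D iX Ga] comp_hom[OF D Gb iY]])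
      then show "Comp D (\<iota> Y) (Far (fcomp K P) a) = Comp D (Far G a) (\<iota> X)"
        by (simp add: Ka)
    qed
  qed
  then show ?thesis unfolding faint_extension_def using K by blast
qed

end


section \<open>Model categories and their duals\<close>

lemma op_model_sel [simp]:
  "Obj (op_model M) = Obj M" "Arr (op_model M) = Arr M" "Dom (op_model M) = Cod M"
  "Cod (op_model M) = Dom M" "Ident (op_model M) = Ident M"
  "Comp (op_model M) g f = Comp M f g"
  "Weq (op_model M) = Weq M" "Cof (op_model M) = Fib M" "Fib (op_model M) = Cof M"
  by (simp_all add: op_model_def)

lemma op_model_op [simp]: "op_model (op_model M) = M"
  by (simp add: op_model_def)

lemma hom_op_model [simp]: "hom (op_model M) X Y = hom M Y X"
  unfolding hom_def by auto

lemma op_category: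
  fixes M :: "('o, 'a) model_cat"
  assumes "category M"
  shows "category (op_model M)"
  by (rule categoryI)
    (use id_hom[OF assms] comp_hom[OF assms] id_left[OF assms] id_right[OF assms]
      comp_assoc[OF assms] assms in \<open>auto simp: category_def\<close>)

text \<open>This lets the weak equivalences, cofibrations and fibrations be forgotten when the opposite
  model category is compared with the opposite category.\<close>

lemma has_finite_limits_cong:
  assumes "Obj C = Obj D" "Arr C = Arr D" "Dom C = Dom D" "Cod C = Cod D"
    "Ident C = Ident D" "Comp C = Comp D"
  shows "has_finite_limits C \<longleftrightarrow> has_finite_limits D"
  unfolding has_finite_limits_def is_limit_def is_cone_def is_functor_def category_def hom_def
    assms by (rule refl)

lemma has_finite_limits_op_model:
  "has_finite_limits (op_model M) \<longleftrightarrow> has_finite_colimits M"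
  "has_finite_colimits (op_model M) \<longleftrightarrow> has_finite_limits M"
  unfolding has_finite_colimits_def
  by (rule has_finite_limits_cong; simp add: op_cat_def op_model_def)+

lemma comm_square_op: "comm_square (op_model M) f g u v \<longleftrightarrow> comm_square M g f v u"
  unfolding comm_square_def by auto

lemma is_retract_op: "is_retract (op_model M) f g \<longleftrightarrow> is_retract M f g"
  unfolding is_retract_def comm_square_op by simp blast

lemma has_lift_op: "has_lift (op_model M) i p \<longleftrightarrow> has_lift M p i"
  unfolding has_lift_def comm_square_op by auto

lemma functorial_factorization_op:
  assumes "functorial_factorization M L R l r m"
  shows "functorial_factorization (op_model M) R L r l (\<lambda>f g u v. m g f v u)"
proof -
  have a: "l f \<in> L \<and> r f \<in> R \<and> l f \<in> Arr M \<and> Dom M (l f) = Dom M f \<and>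
       r f \<in> hom M (Cod M (l f)) (Cod M f) \<and> Comp M (r f) (l f) = f" if "f \<in> Arr M" for f
    using assms that unfolding functorial_factorization_def by blast
  then have rl: "Dom M (r f) = Cod M (l f)" "r f \<in> Arr M" "Cod M (r f) = Cod M f"
    if "f \<in> Arr M" for f
    using that unfolding hom_def by auto
  have arr: "f \<in> Arr M \<and> g \<in> Arr M" if "comm_square M f g u v" for f g u v
    using that unfolding comm_square_def by blast
  show ?thesis
    unfolding functorial_factorization_def comm_square_op
  proof (intro conjI ballI allI impI)
    fix f assume "f \<in> Arr (op_model M)"
    then have f: "f \<in> Arr M" by simp
    show "r f \<in> R" "l f \<in> L" "r f \<in> Arr (op_model M)" "Dom (op_model M) (r f) = Dom (op_model M) f"
      "l f \<in> hom (op_model M) (Cod (op_model M) (r f)) (Cod (op_model M) f)"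
      "Comp (op_model M) (l f) (r f) = f"
      using a[OF f] rl[OF f] by (auto simp: hom_def)
    show "m f f (Ident (op_model M) (Cod (op_model M) f)) (Ident (op_model M) (Dom (op_model M) f)) =
        Ident (op_model M) (Cod (op_model M) (r f))"
      using assms f rl[OF f] unfolding functorial_factorization_def by simp
  next
    fix f g u v assume s: "comm_square M g f v u"
    show "m g f v u \<in> hom (op_model M) (Cod (op_model M) (r f)) (Cod (op_model M) (r g))"
      "Comp (op_model M) (m g f v u) (r f) = Comp (op_model M) (r g) u"
      "Comp (op_model M) (l g) (m g f v u) = Comp (op_model M) v (l f)"
      using assms s rl arr[OF s] unfolding functorial_factorization_def by auto
  next
    fix f g h u v u' v' assume "comm_square M g f v u" "comm_square M h g v' u'"
    then show "m h f (Comp (op_model M) v' v) (Comp (op_model M) u' u) =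
        Comp (op_model M) (m h g v' u') (m g f v u)"
      using assms unfolding functorial_factorization_def by simp
  qed
qed

locale model =
  fixes M :: "('o, 'a) model_cat"
  assumes model_category: "model_category M"
begin

abbreviation comp :: "'a \<Rightarrow> 'a \<Rightarrow> 'a" (infixr "\<cdot>" 70) where "g \<cdot> f \<equiv> Comp M g f"
abbreviation Id :: "'o \<Rightarrow> 'a" where "Id \<equiv> Ident M"
abbreviation mhom :: "'o \<Rightarrow> 'o \<Rightarrow> 'a set" where "mhom \<equiv> hom M"

lemma cat: "category M"
  using model_category unfolding model_category_def by blast

lemmas comp_in = comp_hom[OF cat] and assoc = comp_assoc[OF cat]
  and idl = id_left[OF cat] and idr = id_right[OF cat] and id_in = id_hom[OF cat]
  and hom_obj = homD(4,5)[OF cat]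

text \<open>The axioms are self-dual. A statement about right homotopies and fibrations is therefore the
  one about left homotopies and cofibrations, read in the opposite model category.\<close>

lemma model_op: "model (op_model M)"
proof (rule model.intro)
  have mc: "model_category M" by (rule model_category)
  have w: "(f \<in> Weq M \<longrightarrow> g \<in> Weq M \<longrightarrow> Comp M g f \<in> Weq M) \<and>
       (f \<in> Weq M \<longrightarrow> Comp M g f \<in> Weq M \<longrightarrow> g \<in> Weq M) \<and>
       (g \<in> Weq M \<longrightarrow> Comp M g f \<in> Weq M \<longrightarrow> f \<in> Weq M)"
    if "f \<in> hom M X Y" "g \<in> hom M Y Z" for f g X Y Z
    using mc that unfolding model_category_def by blast
  have rt: "(g \<in> Weq M \<longrightarrow> f \<in> Weq M) \<and> (g \<in> Cof M \<longrightarrow> f \<in> Cof M) \<and> (g \<in> Fib M \<longrightarrow> f \<in> Fib M)"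
    if "is_retract M f g" for f g
    using mc that unfolding model_category_def by blast
  have li: "has_lift M i p" if "i \<in> Cof M" "p \<in> Fib M" "i \<in> Weq M \<or> p \<in> Weq M" for i p
    using mc that unfolding model_category_def by blast
  have f1: "\<exists>l r m. functorial_factorization M (Cof M) (Fib M \<inter> Weq M) l r m"
    and f2: "\<exists>l r m. functorial_factorization M (Cof M \<inter> Weq M) (Fib M) l r m"
    using mc unfolding model_category_def by blast+
  show "model_category (op_model M)"
    unfolding model_category_def has_finite_limits_op_model is_retract_op has_lift_op
  proof (intro conjI allI ballI impI)
    show "\<exists>l r m. functorial_factorization (op_model M) (Cof (op_model M))
        (Fib (op_model M) \<inter> Weq (op_model M)) l r m"
      using f2 functorial_factorization_op by (fastforce simp only: op_model_sel)
    show "\<exists>l r m. functorial_factorization (op_model M) (Cof (op_model M) \<inter> Weq (op_model M))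
        (Fib (op_model M)) l r m"
      using f1 functorial_factorization_op by (fastforce simp only: op_model_sel)
  qed (use mc w rt li op_category[OF cat] in \<open>auto simp: model_category_def\<close>)
qed

lemma weq_comp: "f \<in> mhom X Y \<Longrightarrow> g \<in> mhom Y Z \<Longrightarrow> f \<in> Weq M \<Longrightarrow> g \<in> Weq M \<Longrightarrow> g \<cdot> f \<in> Weq M"
  and weq_cancel_right: "f \<in> mhom X Y \<Longrightarrow> g \<in> mhom Y Z \<Longrightarrow> f \<in> Weq M \<Longrightarrow> g \<cdot> f \<in> Weq M \<Longrightarrow> g \<in> Weq M"
  and weq_cancel_left: "f \<in> mhom X Y \<Longrightarrow> g \<in> mhom Y Z \<Longrightarrow> g \<in> Weq M \<Longrightarrow> g \<cdot> f \<in> Weq M \<Longrightarrow> f \<in> Weq M"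
  using model_category unfolding model_category_def by blast+

lemma lifting:
  assumes "i \<in> mhom A B" "i \<in> Cof M" "p \<in> mhom X Y" "p \<in> Fib M" "i \<in> Weq M \<or> p \<in> Weq M"
    and "u \<in> mhom A X" "v \<in> mhom B Y" "v \<cdot> i = p \<cdot> u"
  shows "\<exists>h\<in>mhom B X. h \<cdot> i = u \<and> p \<cdot> h = v"
proof -
  have "has_lift M i p" using model_category assms unfolding model_category_def by blast
  moreover have "comm_square M i p u v"
    using assms homD(1-3)[OF cat assms(1)] homD(1-3)[OF cat assms(3)]
    unfolding comm_square_def by simp
  ultimately show ?thesis
    using homD(2,3)[OF cat assms(1)] homD(2,3)[OF cat assms(3)] unfolding has_lift_def by blast
qed

lemma factor_cof:
  assumes f: "f \<in> mhom X Y"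
  obtains E l r where "l \<in> mhom X E" "r \<in> mhom E Y" "l \<in> Cof M" "r \<in> Fib M" "r \<in> Weq M" "r \<cdot> l = f"
proof -
  obtain l r m where ff: "functorial_factorization M (Cof M) (Fib M \<inter> Weq M) l r m"
    using model_category unfolding model_category_def by blast
  have "l f \<in> Cof M \<and> r f \<in> Fib M \<inter> Weq M \<and> l f \<in> Arr M \<and> Dom M (l f) = Dom M f \<and>
       r f \<in> hom M (Cod M (l f)) (Cod M f) \<and> Comp M (r f) (l f) = f"
    using ff homD(1)[OF cat f] unfolding functorial_factorization_def by blast
  moreover from this have "l f \<in> mhom X (Cod M (l f))"
    using homD(2)[OF cat f] unfolding hom_def by simp
  ultimately show thesis using that homD(2,3)[OF cat f] by blast
qed


lemma retractI:
  assumes "f \<in> mhom A B" "g \<in> mhom A' B'"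
    and "u \<in> mhom A A'" "v \<in> mhom B B'" "v \<cdot> f = g \<cdot> u"
    and "u' \<in> mhom A' A" "v' \<in> mhom B' B" "v' \<cdot> g = f \<cdot> u'"
    and "u' \<cdot> u = Id A" "v' \<cdot> v = Id B"
  shows "is_retract M f g"
  using assms homD(1-3)[OF cat assms(1)] homD(1-3)[OF cat assms(2)]
  unfolding is_retract_def comm_square_def by blast

lemma retract_closed:
  assumes "is_retract M f g"
  shows "g \<in> Weq M \<Longrightarrow> f \<in> Weq M" "g \<in> Cof M \<Longrightarrow> f \<in> Cof M"
  using model_category assms unfolding model_category_def by blast+

text \<open>An identity is a retract of the weak equivalence in a factorization of itself.\<close>

lemma id_weq:
  assumes X: "X \<in> Obj M"
  shows "Id X \<in> Weq M"
proof -
  obtain E l r where lr: "l \<in> mhom X E" "r \<in> mhom E X" "r \<in> Weq M" "r \<cdot> l = Id X"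
    using factor_cof[OF id_in[OF X]] by metis
  have "is_retract M (Id X) r"
    by (rule retractI[OF id_in[OF X] lr(2) lr(1) id_in[OF X] _ lr(2) id_in[OF X]])
      (simp_all add: lr idl[OF id_in[OF X]] idl[OF lr(2)] idr[OF lr(2)])
  then show ?thesis using retract_closed lr by blast
qed

text \<open>The retract argument: a map that lifts against its own trivial fibration factor is a
  retract of its cofibration factor.\<close>

lemma cof_if_lifts:
  assumes f: "f \<in> mhom A B"
    and lift: "\<And>p X Y u v. p \<in> mhom X Y \<Longrightarrow> p \<in> Fib M \<Longrightarrow> p \<in> Weq M \<Longrightarrow> u \<in> mhom A X \<Longrightarrow>
      v \<in> mhom B Y \<Longrightarrow> v \<cdot> f = p \<cdot> u \<Longrightarrow> \<exists>h\<in>mhom B X. h \<cdot> f = u \<and> p \<cdot> h = v"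
  shows "f \<in> Cof M"
proof -
  have A: "A \<in> Obj M" and B: "B \<in> Obj M" using hom_obj[OF f] .
  obtain E l r where lr: "l \<in> mhom A E" "r \<in> mhom E B" "l \<in> Cof M" "r \<in> Fib M" "r \<in> Weq M"
    "r \<cdot> l = f" using factor_cof[OF f] by metis
  obtain h where h: "h \<in> mhom B E" "h \<cdot> f = l" "r \<cdot> h = Id B"
    using lift[OF lr(2,4,5,1) id_in[OF B]] lr(6) idl[OF f] by metis
  have "is_retract M f l"
    by (rule retractI[OF f lr(1) id_in[OF A] h(1) _ id_in[OF A] lr(2)])
      (simp_all add: h lr idl[OF id_in[OF A]] idr[OF lr(1)] idr[OF f])
  then show ?thesis using retract_closed lr by blast
qed

lemma cof_comp:
  assumes f: "f \<in> mhom A B" "f \<in> Cof M" and g: "g \<in> mhom B C" "g \<in> Cof M"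
  shows "g \<cdot> f \<in> Cof M"
proof (rule cof_if_lifts[OF comp_in[OF f(1) g(1)]])
  fix p X Y u v
  assume p: "p \<in> mhom X Y" "p \<in> Fib M" "p \<in> Weq M" and u: "u \<in> mhom A X" and v: "v \<in> mhom C Y"
    and eq: "v \<cdot> g \<cdot> f = p \<cdot> u"
  have "(v \<cdot> g) \<cdot> f = p \<cdot> u" using assoc[OF f(1) g(1) v] eq by simp
  then obtain h where h: "h \<in> mhom B X" "h \<cdot> f = u" "p \<cdot> h = v \<cdot> g"
    using lifting[OF f p(1,2) _ u comp_in[OF g(1) v]] p(3) by blast
  obtain k where k: "k \<in> mhom C X" "k \<cdot> g = h" "p \<cdot> k = v"
    using lifting[OF g p(1,2) _ h(1) v] p(3) h(3) by metis
  then show "\<exists>h\<in>mhom C X. h \<cdot> g \<cdot> f = u \<and> p \<cdot> h = v"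
    using assoc[OF f(1) g(1) k(1)] h(2) by auto
qed


section \<open>Coproducts and cofibrant objects\<close>

lemma op_cat_limit:
  fixes J :: "(nat, nat) cat"
  assumes "is_functor J (op_cat M) D" "finite (Obj J)" "finite (Arr J)"
  shows "\<exists>X \<pi>. is_limit J (op_cat M) D X \<pi>"
  using model_category assms
  unfolding model_category_def has_finite_colimits_def has_finite_limits_def by blast

lemma op_cat_sel [simp]:
  "Obj (op_cat M) = Obj M" "Arr (op_cat M) = Arr M" "Dom (op_cat M) = Cod M"
  "Cod (op_cat M) = Dom M" "Ident (op_cat M) = Id" "Comp (op_cat M) g f = f \<cdot> g"
  "hom (op_cat M) X Y = mhom Y X"
  by (auto simp: op_cat_def hom_def)

lemma op_cat_category: "category (op_cat M)"
  using op_category[OF cat] unfolding category_def hom_def by simp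

text \<open>Limits of this shape in the opposite category are coproducts.\<close>

definition discrete :: "nat set \<Rightarrow> (nat, nat) cat" where
  "discrete S = \<lparr>Obj = S, Arr = S, Dom = id, Cod = id, Ident = id, Comp = (\<lambda>g f. f)\<rparr>"

definition family :: "(nat \<Rightarrow> 'o) \<Rightarrow> (nat, nat, 'o, 'a) cat_functor" where
  "family D = \<lparr>Fob = D, Far = \<lambda>n. Id (D n)\<rparr>"

lemma discrete_functor:
  assumes "\<forall>n\<in>S. D n \<in> Obj M"
  shows "is_functor (discrete S) (op_cat M) (family D)"
proof (rule is_functorI[OF _ op_cat_category])
  show "category (discrete S)" unfolding category_def discrete_def hom_def by auto
  fix X Y Z f g assume "f \<in> hom (discrete S) X Y" "g \<in> hom (discrete S) Y Z"
  then show "Far (family D) (Comp (discrete S) g f) =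
    Comp (op_cat M) (Far (family D) g) (Far (family D) f)"
    using assms idl[OF id_in] by (auto simp: discrete_def family_def hom_def)
qed (use assms id_in in \<open>auto simp: discrete_def family_def hom_def\<close>)

lemma discrete_cone:
  assumes "\<forall>n\<in>S. D n \<in> Obj M"
  shows "is_cone (discrete S) (op_cat M) (family D) X \<pi> \<longleftrightarrow>
    X \<in> Obj M \<and> (\<forall>n\<in>S. \<pi> n \<in> mhom (D n) X)"
  unfolding is_cone_def using assms idr by (auto simp: discrete_def family_def)

lemma coproduct_exists:
  assumes X: "X \<in> Obj M" and Y: "Y \<in> Obj M"
  shows "\<exists>S j0 j1. is_coproduct M X Y S j0 j1"
proof -
  let ?ob = "\<lambda>n::nat. if n = 0 then X else Y"
  have D: "\<forall>n\<in>{0, 1}. ?ob n \<in> Obj M" using X Y by auto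
  obtain S \<pi> where lim: "is_limit (discrete {0, 1}) (op_cat M) (family ?ob) S \<pi>"
    using op_cat_limit[OF discrete_functor[of "{0, 1}" ?ob, OF D]] by (auto simp: discrete_def)
  note l = lim[unfolded is_limit_def discrete_cone[of "{0,1}" ?ob, OF D]]
  have "is_coproduct M X Y S (\<pi> 0) (\<pi> 1)"
    unfolding is_coproduct_def
  proof (intro conjI allI impI)
    show "\<pi> 0 \<in> mhom X S" "\<pi> 1 \<in> mhom Y S" using l by auto
    fix Z a b assume a: "a \<in> mhom X Z" and b: "b \<in> mhom Y Z"
    then show "\<exists>!u. u \<in> mhom S Z \<and> u \<cdot> \<pi> 0 = a \<and> u \<cdot> \<pi> 1 = b"
      using l[THEN conjunct2, rule_format, of Z "\<lambda>n. if n = 0 then a else b"] hom_obj[OF a]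
      by (auto simp: discrete_def)
  qed
  then show ?thesis by blast
qed


lemma coproduct_hom:
  assumes "is_coproduct M X Y S j0 j1"
  shows "j0 \<in> mhom X S" "j1 \<in> mhom Y S"
  using assms unfolding is_coproduct_def by blast+

lemma coproduct_ex:
  assumes "is_coproduct M X Y S j0 j1" "a \<in> mhom X Z" "b \<in> mhom Y Z"
  obtains u where "u \<in> mhom S Z" "u \<cdot> j0 = a" "u \<cdot> j1 = b"
  using assms unfolding is_coproduct_def by blast

lemma coproduct_eq:
  assumes S: "is_coproduct M X Y S j0 j1" and u: "u \<in> mhom S Z" and v: "v \<in> mhom S Z"
    and eq: "u \<cdot> j0 = v \<cdot> j0" "u \<cdot> j1 = v \<cdot> j1"
  shows "u = v"
proof -
  have "\<exists>!w. w \<in> mhom S Z \<and> w \<cdot> j0 = u \<cdot> j0 \<and> w \<cdot> j1 = u \<cdot> j1"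
    using S comp_in[OF coproduct_hom(1)[OF S] u] comp_in[OF coproduct_hom(2)[OF S] u]
    unfolding is_coproduct_def by blast
  then show ?thesis using u v eq by metis
qed

lemma initial_eq:
  assumes "is_initial M Z" "f \<in> mhom Z X" "g \<in> mhom Z X"
  shows "f = g"
  using assms hom_obj[OF assms(2)] unfolding is_initial_def by blast

lemma cofibrant_obj: "cofibrant M X \<Longrightarrow> X \<in> Obj M"
  unfolding cofibrant_def using hom_obj by blast

lemma cofibrant_lift:
  assumes X: "cofibrant M X" and p: "p \<in> mhom A B" "p \<in> Fib M" "p \<in> Weq M" and v: "v \<in> mhom X B"
  shows "\<exists>u\<in>mhom X A. p \<cdot> u = v"
proof -
  obtain Z z where Z: "is_initial M Z" and z: "z \<in> mhom Z X" "z \<in> Cof M"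
    using X unfolding cofibrant_def by blast
  obtain a where a: "a \<in> mhom Z A"
    using Z hom_obj[OF p(1)] unfolding is_initial_def by blast
  have "v \<cdot> z = p \<cdot> a" by (rule initial_eq[OF Z comp_in[OF z(1) v] comp_in[OF a p(1)]])
  then show ?thesis using lifting[OF z p(1,2) _ a v] p(3) by blast
qed

lemma cofibrant_cod:
  assumes X: "cofibrant M X" and f: "f \<in> mhom X Y" "f \<in> Cof M"
  shows "cofibrant M Y"
  using X cof_comp[OF _ _ f] comp_in[OF _ f(1)] unfolding cofibrant_def by blast

text \<open>The injection is the pushout of \<open>0 \<rightarrow> Y\<close>: a lift is given by the prescribed arrow on \<open>X\<close> and
  by a lift on \<open>Y\<close>.\<close>

lemma coproduct_injection_cof:
  assumes S: "is_coproduct M X Y S j0 j1" and Y: "cofibrant M Y"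
  shows "j0 \<in> Cof M"
proof (rule cof_if_lifts[OF coproduct_hom(1)[OF S]])
  note j = coproduct_hom[OF S]
  fix p A B u v
  assume p: "p \<in> mhom A B" "p \<in> Fib M" "p \<in> Weq M" and u: "u \<in> mhom X A" and v: "v \<in> mhom S B"
    and eq: "v \<cdot> j0 = p \<cdot> u"
  obtain w where w: "w \<in> mhom Y A" "p \<cdot> w = v \<cdot> j1"
    using cofibrant_lift[OF Y p comp_in[OF j(2) v]] by blast
  obtain h where h: "h \<in> mhom S A" "h \<cdot> j0 = u" "h \<cdot> j1 = w" by (rule coproduct_ex[OF S u w(1)])
  have "p \<cdot> h = v"
    by (rule coproduct_eq[OF S comp_in[OF h(1) p(1)] v])
      (simp_all add: assoc[OF j(1) h(1) p(1), symmetric] assoc[OF j(2) h(1) p(1), symmetric] h eq w)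
  then show "\<exists>h\<in>mhom S A. h \<cdot> j0 = u \<and> p \<cdot> h = v" using h by blast
qed

lemma coproduct_cofibrant:
  assumes S: "is_coproduct M X Y S j0 j1" and X: "cofibrant M X" and Y: "cofibrant M Y"
  shows "cofibrant M S"
  by (rule cofibrant_cod[OF X coproduct_hom(1)[OF S] coproduct_injection_cof[OF S Y]])

lemma coproduct_swap:
  assumes "is_coproduct M X Y S j0 j1"
  shows "is_coproduct M Y X S j1 j0"
  using assms unfolding is_coproduct_def by (simp add: conj_commute)


section \<open>Cylinders and homotopies\<close>

lemma cylinder_hom:
  assumes "is_cylinder M X Q i0 i1"
  shows "i0 \<in> mhom X Q" "i1 \<in> mhom X Q"
  using assms comp_in unfolding is_cylinder_def is_coproduct_def by blast+

lemma cylinder_projection: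
  assumes "is_cylinder M X Q i0 i1"
  obtains p where "p \<in> mhom Q X" "p \<in> Weq M" "p \<cdot> i0 = Id X" "p \<cdot> i1 = Id X"
  using assms unfolding is_cylinder_def by blast

lemma cylinder_exists:
  assumes X: "X \<in> Obj M"
  obtains Q i0 i1 where "is_cylinder M X Q i0 i1"
proof -
  obtain S j0 j1 where S: "is_coproduct M X X S j0 j1" using coproduct_exists[OF X X] by blast
  obtain f where f: "f \<in> mhom S X" "f \<cdot> j0 = Id X" "f \<cdot> j1 = Id X"
    by (rule coproduct_ex[OF S id_in[OF X] id_in[OF X]])
  obtain Q i p where ip: "i \<in> mhom S Q" "p \<in> mhom Q X" "i \<in> Cof M" "p \<in> Weq M" "p \<cdot> i = f"
    using factor_cof[OF f(1)] by metis
  have "p \<cdot> i \<cdot> j0 = Id X" "p \<cdot> i \<cdot> j1 = Id X"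
    using assoc[OF coproduct_hom(1)[OF S] ip(1,2)] assoc[OF coproduct_hom(2)[OF S] ip(1,2)] ip(5) f
    by simp_all
  then have "is_cylinder M X Q (i \<cdot> j0) (i \<cdot> j1)"
    unfolding is_cylinder_def using S ip by blast
  then show thesis by (rule that)
qed

lemma cylinder_swap:
  assumes "is_cylinder M X Q i0 i1"
  shows "is_cylinder M X Q i1 i0"
  using assms coproduct_swap unfolding is_cylinder_def by blast

lemma cylinder_cofibrant:
  assumes Q: "is_cylinder M X Q i0 i1" and X: "cofibrant M X"
  shows "cofibrant M Q"
  using Q coproduct_cofibrant[OF _ X X] cofibrant_cod unfolding is_cylinder_def by blast

lemma cylinder_end:
  assumes Q: "is_cylinder M X Q i0 i1" and X: "cofibrant M X"
  shows "i0 \<in> Cof M" "i0 \<in> Weq M"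
proof -
  show "i0 \<in> Cof M"
    using Q coproduct_injection_cof[OF _ X] cof_comp coproduct_hom(1) unfolding is_cylinder_def by blast
  show "i0 \<in> Weq M"
    using cylinder_projection[OF Q] cylinder_hom[OF Q] weq_cancel_left id_weq[OF cofibrant_obj[OF X]]
    by metis
qed

text \<open>A homotopy lifts through a trivial fibration with prescribed lifts of its ends, because the
  ends together are a cofibration \<open>X + X \<rightarrow> Q\<close>. The dual, \<open>path_lift\<close>, extends path homotopies
  along trivial cofibrations.\<close>

lemma cylinder_lift:
  assumes Q: "is_cylinder M X Q i0 i1" and q: "q \<in> mhom A B" "q \<in> Fib M" "q \<in> Weq M"
    and h: "h \<in> mhom Q B" and u: "u \<in> mhom X A" "h \<cdot> i0 = q \<cdot> u" and v: "v \<in> mhom X A" "h \<cdot> i1 = q \<cdot> v"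
  obtains k where "k \<in> mhom Q A" "q \<cdot> k = h" "k \<cdot> i0 = u" "k \<cdot> i1 = v"
proof -
  obtain S j0 j1 i where S: "is_coproduct M X X S j0 j1" and i: "i \<in> mhom S Q" "i \<in> Cof M"
    and ij: "i0 = i \<cdot> j0" "i1 = i \<cdot> j1"
    using Q unfolding is_cylinder_def by blast
  note j = coproduct_hom[OF S]
  obtain w where w: "w \<in> mhom S A" "w \<cdot> j0 = u" "w \<cdot> j1 = v" by (rule coproduct_ex[OF S u(1) v(1)])
  have "h \<cdot> i = q \<cdot> w"
    by (rule coproduct_eq[OF S comp_in[OF i(1) h] comp_in[OF w(1) q(1)]])
      (simp_all add: assoc[OF j(1) w(1) q(1), symmetric] assoc[OF j(2) w(1) q(1), symmetric]
        assoc[OF j(1) i(1) h, symmetric] assoc[OF j(2) i(1) h, symmetric] w u v ij[symmetric])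
  then obtain k where k: "k \<in> mhom Q A" "k \<cdot> i = w" "q \<cdot> k = h"
    using lifting[OF i q(1,2) _ w(1) h] q(3) by blast
  show thesis
    using that[OF k(1,3)] k(2) w(2,3) ij assoc[OF j(1) i(1) k(1)] assoc[OF j(2) i(1) k(1)] by simp
qed


lemma path_lift:
  assumes P: "is_cylinder (op_model M) Y P p0 p1" and i: "i \<in> mhom A B" "i \<in> Cof M" "i \<in> Weq M"
    and k: "k \<in> mhom A P" and a: "a \<in> mhom B Y" "p0 \<cdot> k = a \<cdot> i" and b: "b \<in> mhom B Y" "p1 \<cdot> k = b \<cdot> i"
  obtains h where "h \<in> mhom B P" "h \<cdot> i = k" "p0 \<cdot> h = a" "p1 \<cdot> h = b"
proof -
  interpret op: model "op_model M" by (rule model_op)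
  show thesis
    by (rule op.cylinder_lift[OF P, of i B A k a b]) (use i k a b that in simp_all)
qed

lemma left_homotopicI:
  assumes "is_cylinder M X Q i0 i1" "h \<in> mhom Q Y"
  shows "left_homotopic M (h \<cdot> i0) (h \<cdot> i1)"
proof -
  have i: "h \<cdot> i0 \<in> mhom X Y" "h \<cdot> i1 \<in> mhom X Y"
    using cylinder_hom[OF assms(1)] comp_in assms(2) by blast+
  show ?thesis unfolding left_homotopic_def
    using homD(1-3)[OF cat i(1)] i(2) assms by auto
qed

lemma left_homotopicE:
  assumes "left_homotopic M f g" "f \<in> mhom X Y"
  obtains Q i0 i1 h where "is_cylinder M X Q i0 i1" "h \<in> mhom Q Y" "h \<cdot> i0 = f" "h \<cdot> i1 = g"
  using assms homD(1-3)[OF cat assms(2)] unfolding left_homotopic_def by auto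

lemma left_homotopic_hom: "left_homotopic M f g \<Longrightarrow> f \<in> mhom X Y \<Longrightarrow> g \<in> mhom X Y"
  using homD(1-3)[OF cat] unfolding left_homotopic_def by metis

lemma right_homotopicI:
  assumes "is_cylinder (op_model M) Y P p0 p1" "k \<in> mhom X P"
  shows "right_homotopic M (p0 \<cdot> k) (p1 \<cdot> k)"
proof -
  interpret op: model "op_model M" by (rule model_op)
  show ?thesis using op.left_homotopicI[OF assms(1)] assms(2) unfolding right_homotopic_def by simp
qed

lemma right_homotopicE:
  assumes "right_homotopic M f g" "f \<in> mhom X Y"
  obtains P p0 p1 k where "is_cylinder (op_model M) Y P p0 p1" "k \<in> mhom X P" "p0 \<cdot> k = f" "p1 \<cdot> k = g"
proof -
  interpret op: model "op_model M" by (rule model_op)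
  show thesis
    using op.left_homotopicE[of f g Y X] assms that unfolding right_homotopic_def by simp metis
qed

lemma left_homotopic_refl:
  assumes f: "f \<in> mhom X Y"
  shows "left_homotopic M f f"
proof -
  obtain Q i0 i1 where Q: "is_cylinder M X Q i0 i1" using cylinder_exists hom_obj(1)[OF f] by metis
  obtain p where p: "p \<in> mhom Q X" "p \<cdot> i0 = Id X" "p \<cdot> i1 = Id X" using cylinder_projection[OF Q] by metis
  show ?thesis
    using left_homotopicI[OF Q comp_in[OF p(1) f]] cylinder_hom[OF Q] p idr[OF f]
      assoc[OF _ p(1) f] by metis
qed

lemma left_homotopic_sym:
  assumes "left_homotopic M f g" "f \<in> mhom X Y"
  shows "left_homotopic M g f"
  using left_homotopicE[OF assms] left_homotopicI[OF cylinder_swap] by metis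

lemma left_homotopic_post:
  assumes "left_homotopic M f g" and f: "f \<in> mhom X Y" and k: "k \<in> mhom Y Z"
  shows "left_homotopic M (k \<cdot> f) (k \<cdot> g)"
proof -
  obtain Q i0 i1 h where Q: "is_cylinder M X Q i0 i1" "h \<in> mhom Q Y" "h \<cdot> i0 = f" "h \<cdot> i1 = g"
    by (rule left_homotopicE[OF assms(1) f])
  show ?thesis
    using left_homotopicI[OF Q(1) comp_in[OF Q(2) k]] Q(3,4)
      assoc[OF cylinder_hom(1)[OF Q(1)] Q(2) k] assoc[OF cylinder_hom(2)[OF Q(1)] Q(2) k] by simp
qed

text \<open>The end \<open>i0\<close> of the cylinder is a trivial cofibration, so the path homotopy from \<open>f\<close> to \<open>h\<close>
  extends along it to the whole cylinder, with the left homotopy and the constant homotopy at \<open>h\<close> as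
  prescribed ends. Over the other end \<open>i1\<close> the extension is a path homotopy from \<open>g\<close> to \<open>h\<close>. This
  single fact contains the comparison of left with right homotopy (take \<open>h = f\<close>) and transitivity,
  without gluing cylinders.\<close>

lemma homotopy_transport:
  assumes X: "cofibrant M X" and f: "f \<in> mhom X Y"
    and fg: "left_homotopic M f g" and fh: "right_homotopic M f h"
  shows "right_homotopic M g h"
proof -
  obtain Q i0 i1 H where Q: "is_cylinder M X Q i0 i1" and H: "H \<in> mhom Q Y" "H \<cdot> i0 = f" "H \<cdot> i1 = g"
    by (rule left_homotopicE[OF fg f])
  obtain P p0 p1 k where P: "is_cylinder (op_model M) Y P p0 p1"
    and k: "k \<in> mhom X P" "p0 \<cdot> k = f" "p1 \<cdot> k = h"
    by (rule right_homotopicE[OF fh f])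
  obtain p where p: "p \<in> mhom Q X" "p \<cdot> i0 = Id X" "p \<cdot> i1 = Id X" using cylinder_projection[OF Q] by metis
  interpret op: model "op_model M" by (rule model_op)
  have p01: "p0 \<in> mhom P Y" "p1 \<in> mhom P Y" using op.cylinder_hom[OF P] by simp_all
  note i = cylinder_hom[OF Q]
  have h: "h \<in> mhom X Y" using comp_in[OF k(1) p01(2)] k(3) by simp
  have hp: "(h \<cdot> p) \<cdot> i0 = h" "(h \<cdot> p) \<cdot> i1 = h"
    using assoc[OF i(1) p(1) h] assoc[OF i(2) p(1) h] p(2,3) idr[OF h] by simp_all
  obtain L where L: "L \<in> mhom Q P" "p0 \<cdot> L = H" "p1 \<cdot> L = h \<cdot> p"
    using path_lift[OF P i(1) cylinder_end[OF Q X] k(1) H(1) _ comp_in[OF p(1) h]] H(2) k(2,3) hp(1)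
    by metis
  have "p0 \<cdot> L \<cdot> i1 = g" "p1 \<cdot> L \<cdot> i1 = h"
    using assoc[OF i(2) L(1) p01(1)] assoc[OF i(2) L(1) p01(2)] L(2,3) H(3) hp(2) by simp_all
  then show ?thesis using right_homotopicI[OF P comp_in[OF i(2) L(1)]] by simp
qed

text \<open>Maps into the total space of a trivial fibration are determined up to homotopy by their
  composites with it: lift the constant homotopy.\<close>

lemma left_homotopic_if_equal_after_trivial_fibration:
  assumes q: "q \<in> mhom A B" "q \<in> Fib M" "q \<in> Weq M"
    and u: "u \<in> mhom X A" and v: "v \<in> mhom X A" and eq: "q \<cdot> u = q \<cdot> v"
  shows "left_homotopic M u v"
proof -
  obtain Q i0 i1 where Q: "is_cylinder M X Q i0 i1" using cylinder_exists hom_obj(1)[OF u] by metis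
  obtain p where p: "p \<in> mhom Q X" "p \<cdot> i0 = Id X" "p \<cdot> i1 = Id X" using cylinder_projection[OF Q] by metis
  note i = cylinder_hom[OF Q]
  have qu: "q \<cdot> u \<in> mhom X B" by (rule comp_in[OF u q(1)])
  have "((q \<cdot> u) \<cdot> p) \<cdot> i0 = q \<cdot> u" "((q \<cdot> u) \<cdot> p) \<cdot> i1 = q \<cdot> v"
    using assoc[OF i(1) p(1) qu] assoc[OF i(2) p(1) qu] p(2,3) idr[OF qu] eq by simp_all
  then obtain k where "k \<in> mhom Q A" "k \<cdot> i0 = u" "k \<cdot> i1 = v"
    using cylinder_lift[OF Q q comp_in[OF p(1) qu] u _ v] by metis
  then show ?thesis using left_homotopicI[OF Q] by metis
qed


lemma fibrant_dom:
  assumes "fibrant M Y" "f \<in> mhom X Y" "f \<in> Fib M"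
  shows "fibrant M X"
proof -
  interpret op: model "op_model M" by (rule model_op)
  show ?thesis using op.cofibrant_cod[of Y f X] assms unfolding fibrant_def by simp
qed

lemma fibrant_extension:
  assumes Y: "fibrant M Y" and i: "i \<in> mhom A B" "i \<in> Cof M" "i \<in> Weq M" and v: "v \<in> mhom A Y"
  shows "\<exists>u\<in>mhom B Y. u \<cdot> i = v"
proof -
  interpret op: model "op_model M" by (rule model_op)
  show ?thesis using op.cofibrant_lift[of Y i B A v] assms unfolding fibrant_def by simp
qed

lemma right_homotopic_refl: "f \<in> mhom X Y \<Longrightarrow> right_homotopic M f f"
proof -
  interpret op: model "op_model M" by (rule model_op)
  show "f \<in> mhom X Y \<Longrightarrow> right_homotopic M f f"
    using op.left_homotopic_refl[of f Y X] unfolding right_homotopic_def by simp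
qed

lemma right_homotopic_pre:
  assumes "right_homotopic M f g" and "f \<in> mhom X Y" and "k \<in> mhom W X"
  shows "right_homotopic M (f \<cdot> k) (g \<cdot> k)"
proof -
  interpret op: model "op_model M" by (rule model_op)
  show ?thesis using op.left_homotopic_post[of f g Y X k W] assms unfolding right_homotopic_def by simp
qed

lemma homotopy_transport_op:
  assumes "fibrant M Y" and "f \<in> mhom X Y"
    and "right_homotopic M f g" and "left_homotopic M f h"
  shows "left_homotopic M g h"
proof -
  interpret op: model "op_model M" by (rule model_op)
  show ?thesis using op.homotopy_transport[of Y f X g h] assms
    unfolding right_homotopic_def fibrant_def by simp
qed

text \<open>A path homotopy extends along a trivial cofibration with prescribed ends.\<close>

lemma right_homotopic_if_homotopic_on_trivial_cofibration:
  assumes j: "j \<in> mhom A B" "j \<in> Cof M" "j \<in> Weq M"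
    and u: "u \<in> mhom B Y" and v: "v \<in> mhom B Y" and uv: "right_homotopic M (u \<cdot> j) (v \<cdot> j)"
  shows "right_homotopic M u v"
proof -
  obtain P p0 p1 k where P: "is_cylinder (op_model M) Y P p0 p1"
    and k: "k \<in> mhom A P" "p0 \<cdot> k = u \<cdot> j" "p1 \<cdot> k = v \<cdot> j"
    by (rule right_homotopicE[OF uv comp_in[OF j(1) u]])
  obtain h where "h \<in> mhom B P" "p0 \<cdot> h = u" "p1 \<cdot> h = v"
    using path_lift[OF P j k(1) u k(2) v k(3)] by metis
  then show ?thesis using right_homotopicI[OF P] by metis
qed

text \<open>Transport turns a left homotopy into a reversed right one when the source is cofibrant, and
  back when the target is fibrant; left homotopies can be reversed by exchanging the ends of the
  cylinder.\<close>

lemma left_iff_right_homotopic: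
  assumes X: "cofibrant M X" and Y: "fibrant M Y" and f: "f \<in> mhom X Y"
  shows "left_homotopic M f g \<longleftrightarrow> right_homotopic M f g"
proof
  assume l: "left_homotopic M f g"
  then have "right_homotopic M g f" "g \<in> mhom X Y"
    using homotopy_transport[OF X f l right_homotopic_refl[OF f]] left_homotopic_hom[OF l f] by auto
  with l show "right_homotopic M f g"
    using homotopy_transport[OF X _ left_homotopic_sym[OF l f] right_homotopic_refl] by blast
next
  assume r: "right_homotopic M f g"
  have "left_homotopic M g f" by (rule homotopy_transport_op[OF Y f r left_homotopic_refl[OF f]])
  moreover have "g \<in> mhom X Y"
    using r homD(1-3)[OF cat f] unfolding right_homotopic_def left_homotopic_def by simp
  ultimately show "left_homotopic M f g" using left_homotopic_sym by blast
qed

lemma homotopic_iff_left: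
  assumes "cofibrant M X" "fibrant M Y" "f \<in> mhom X Y"
  shows "homotopic M f g \<longleftrightarrow> left_homotopic M f g"
  using left_iff_right_homotopic[OF assms] unfolding homotopic_def by blast

lemma homotopic_iff_right:
  assumes "cofibrant M X" "fibrant M Y" "f \<in> mhom X Y"
  shows "homotopic M f g \<longleftrightarrow> right_homotopic M f g"
  using left_iff_right_homotopic[OF assms] unfolding homotopic_def by blast

lemma homotopic_hom: "homotopic M f g \<Longrightarrow> f \<in> mhom X Y \<Longrightarrow> g \<in> mhom X Y"
  using left_homotopic_hom unfolding homotopic_def by blast

lemma homotopic_trans:
  assumes X: "cofibrant M X" and Y: "fibrant M Y" and f: "f \<in> mhom X Y"
    and fg: "homotopic M f g" and gh: "homotopic M g h"
  shows "homotopic M f h"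
proof -
  have g: "g \<in> mhom X Y" using homotopic_hom fg f by blast
  have "left_homotopic M g f" using fg left_homotopic_sym f unfolding homotopic_def by blast
  then have "right_homotopic M f h"
    using homotopy_transport[OF X g] gh unfolding homotopic_def by blast
  then show ?thesis using homotopic_iff_right[OF X Y f] by blast
qed

lemma homotopic_sym:
  assumes X: "cofibrant M X" and Y: "fibrant M Y" and f: "f \<in> mhom X Y" and fg: "homotopic M f g"
  shows "homotopic M g f"
  using fg left_homotopic_sym[OF _ f] homotopic_iff_left[OF X Y homotopic_hom[OF fg f]]
  unfolding homotopic_def by blast

lemma homotopic_refl: "f \<in> mhom X Y \<Longrightarrow> homotopic M f f"
  using left_homotopic_refl right_homotopic_refl unfolding homotopic_def by blast


section \<open>The homotopy category\<close>

definition bifibrant :: "'o \<Rightarrow> bool" where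
  "bifibrant X \<longleftrightarrow> cofibrant M X \<and> fibrant M X"

abbreviation cls :: "'a \<Rightarrow> 'a set" where "cls \<equiv> homotopy_class M"

lemma class_eq_iff:
  assumes X: "cofibrant M X" and Y: "fibrant M Y" and f: "f \<in> mhom X Y" and g: "g \<in> mhom X Y"
  shows "cls f = cls g \<longleftrightarrow> homotopic M f g"
proof
  assume "cls f = cls g"
  then show "homotopic M f g"
    using homotopic_refl[OF g] unfolding homotopy_class_def by blast
next
  assume fg: "homotopic M f g"
  show "cls f = cls g"
    unfolding homotopy_class_def
    using homotopic_trans[OF X Y f fg] homotopic_trans[OF X Y g homotopic_sym[OF X Y f fg]] by blast
qed

lemma homotopic_comp:
  assumes X: "bifibrant X" and Y: "bifibrant Y" and Z: "bifibrant Z"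
    and f: "f \<in> mhom X Y" "homotopic M f f'" and g: "g \<in> mhom Y Z" "homotopic M g g'"
  shows "homotopic M (g \<cdot> f) (g' \<cdot> f')"
proof -
  have f': "f' \<in> mhom X Y" and g': "g' \<in> mhom Y Z" using homotopic_hom f g by blast+
  have X': "cofibrant M X" and Z': "fibrant M Z" using X Z unfolding bifibrant_def by blast+
  have gf: "g \<cdot> f \<in> mhom X Z" "g \<cdot> f' \<in> mhom X Z" using comp_in f(1) f' g(1) by blast+
  have "homotopic M (g \<cdot> f) (g \<cdot> f')"
    using left_homotopic_post[OF _ f(1) g(1)] f(2) homotopic_iff_left[OF X' Z' gf(1)]
    unfolding homotopic_def by blast
  moreover have "homotopic M (g \<cdot> f') (g' \<cdot> f')"
    using right_homotopic_pre[OF _ g(1) f'] g(2) homotopic_iff_right[OF X' Z' gf(2)]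
    unfolding homotopic_def by blast
  ultimately show ?thesis by (rule homotopic_trans[OF X' Z' gf(1)])
qed

lemma class_dom_cod:
  assumes f: "f \<in> mhom X Y"
  shows "Dom (HoK M) (cls f) = X" "Cod (HoK M) (cls f) = Y"
proof -
  have "f \<in> cls f" using homotopic_refl[OF f] by (simp add: homotopy_class_def)
  moreover have "Dom M g = X \<and> Cod M g = Y" if "g \<in> cls f" for g
    using homotopic_hom[OF _ f] homD(2,3)[OF cat] that by (fastforce simp: homotopy_class_def)
  ultimately have "Dom M ` cls f = {X}" "Cod M ` cls f = {Y}" by force+
  then show "Dom (HoK M) (cls f) = X" "Cod (HoK M) (cls f) = Y" by (simp_all add: HoK_def)
qed

lemma HoK_obj: "X \<in> Obj (HoK M) \<longleftrightarrow> bifibrant X"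
  using cofibrant_obj unfolding HoK_def bifibrant_def by auto

lemma HoK_hom_iff:
  "c \<in> hom (HoK M) X Y \<longleftrightarrow> bifibrant X \<and> bifibrant Y \<and> (\<exists>f\<in>mhom X Y. c = cls f)"
proof
  assume c: "c \<in> hom (HoK M) X Y"
  then obtain f where f: "f \<in> Arr M" "c = cls f" "bifibrant (Dom M f)" "bifibrant (Cod M f)"
    unfolding hom_def HoK_def bifibrant_def by auto
  moreover have "Dom M f = X" "Cod M f = Y"
    using class_dom_cod[OF arr_hom[OF f(1)]] c f(2) unfolding hom_def by auto
  ultimately show "bifibrant X \<and> bifibrant Y \<and> (\<exists>f\<in>mhom X Y. c = cls f)"
    using arr_hom[OF f(1)] by auto
next
  assume "bifibrant X \<and> bifibrant Y \<and> (\<exists>f\<in>mhom X Y. c = cls f)"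
  then obtain f where b: "bifibrant X" "bifibrant Y" and f: "f \<in> mhom X Y" "c = cls f" by blast
  have "c \<in> Arr (HoK M)"
    using b f homD(1-3)[OF cat f(1)] unfolding HoK_def bifibrant_def by auto
  then show "c \<in> hom (HoK M) X Y"
    using class_dom_cod[OF f(1)] f(2) unfolding hom_def by simp
qed

lemma class_hom: "bifibrant X \<Longrightarrow> bifibrant Y \<Longrightarrow> f \<in> mhom X Y \<Longrightarrow> cls f \<in> hom (HoK M) X Y"
  using HoK_hom_iff by blast

lemma HoK_ident: "Ident (HoK M) X = cls (Id X)"
  by (simp add: HoK_def)

lemma HoK_comp:
  assumes X: "bifibrant X" and Y: "bifibrant Y" and Z: "bifibrant Z"
    and f: "f \<in> mhom X Y" and g: "g \<in> mhom Y Z"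
  shows "Comp (HoK M) (cls g) (cls f) = cls (g \<cdot> f)"
proof -
  have "cls (g' \<cdot> f') = cls (g \<cdot> f)" if "f' \<in> cls f" "g' \<in> cls g" for f' g'
  proof -
    have h: "homotopic M f f'" "homotopic M g g'" using that unfolding homotopy_class_def by auto
    have "homotopic M (g \<cdot> f) (g' \<cdot> f')" by (rule homotopic_comp[OF X Y Z f h(1) g h(2)])
    then show ?thesis
      using class_eq_iff[of X Z "g \<cdot> f" "g' \<cdot> f'"] homotopic_hom[OF _ comp_in[OF f g]]
        comp_in[OF f g] X Z unfolding bifibrant_def by blast
  qed
  moreover have "f \<in> cls f" "g \<in> cls g"
    using homotopic_refl f g unfolding homotopy_class_def by blast+
  ultimately have "(\<Union>g'\<in>cls g. \<Union>f'\<in>cls f. cls (g' \<cdot> f')) = cls (g \<cdot> f)" by blast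
  then show ?thesis by (simp add: HoK_def)
qed

lemma bifibrant_obj: "bifibrant X \<Longrightarrow> X \<in> Obj M"
  using cofibrant_obj unfolding bifibrant_def by blast

lemma HoK_category: "category (HoK M)"
proof (rule categoryI)
  fix c assume "c \<in> Arr (HoK M)"
  then have "c \<in> hom (HoK M) (Dom (HoK M) c) (Cod (HoK M) c)" by (rule arr_hom)
  then show "Dom (HoK M) c \<in> Obj (HoK M)" "Cod (HoK M) c \<in> Obj (HoK M)"
    unfolding HoK_hom_iff HoK_obj by blast+
next
  fix X assume "X \<in> Obj (HoK M)"
  then show "Ident (HoK M) X \<in> hom (HoK M) X X"
    using id_in bifibrant_obj unfolding HoK_obj HoK_hom_iff HoK_ident by blast
next
  fix X Y Z f g assume f: "f \<in> hom (HoK M) X Y" and g: "g \<in> hom (HoK M) Y Z"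
  obtain f' where f': "bifibrant X" "bifibrant Y" "f' \<in> mhom X Y" "f = cls f'"
    using f unfolding HoK_hom_iff by blast
  obtain g' where g': "bifibrant Z" "g' \<in> mhom Y Z" "g = cls g'"
    using g unfolding HoK_hom_iff by blast
  show "Comp (HoK M) g f \<in> hom (HoK M) X Z"
    using HoK_comp[OF f'(1,2) g'(1) f'(3) g'(2)] class_hom[OF f'(1) g'(1) comp_in[OF f'(3) g'(2)]]
      f'(4) g'(3) by simp
next
  fix X Y c assume c: "c \<in> hom (HoK M) X Y"
  obtain f where f: "bifibrant X" "bifibrant Y" "f \<in> mhom X Y" "c = cls f"
    using c unfolding HoK_hom_iff by blast
  note X = bifibrant_obj[OF f(1)] and Y = bifibrant_obj[OF f(2)]
  show "Comp (HoK M) c (Ident (HoK M) X) = c"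
    using HoK_comp[OF f(1,1,2) id_in[OF X] f(3)] f(4) idr[OF f(3)] by (simp add: HoK_ident)
  show "Comp (HoK M) (Ident (HoK M) Y) c = c"
    using HoK_comp[OF f(1,2,2,3) id_in[OF Y]] f(4) idl[OF f(3)] by (simp add: HoK_ident)
next
  fix W X Y Z c d e
  assume c: "c \<in> hom (HoK M) W X" and d: "d \<in> hom (HoK M) X Y" and e: "e \<in> hom (HoK M) Y Z"
  obtain f where f: "bifibrant W" "bifibrant X" "f \<in> mhom W X" "c = cls f"
    using c unfolding HoK_hom_iff by blast
  obtain g where g: "bifibrant Y" "g \<in> mhom X Y" "d = cls g"
    using d unfolding HoK_hom_iff by blast
  obtain h where h: "bifibrant Z" "h \<in> mhom Y Z" "e = cls h"
    using e unfolding HoK_hom_iff by blast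
  have gf: "g \<cdot> f \<in> mhom W Y" and hg: "h \<cdot> g \<in> mhom X Z" using comp_in f(3) g(2) h(2) by blast+
  show "Comp (HoK M) e (Comp (HoK M) d c) = Comp (HoK M) (Comp (HoK M) e d) c"
    unfolding f(4) g(3) h(3)
    by (simp add: HoK_comp[OF f(1,2) g(1) f(3) g(2)] HoK_comp[OF f(1) g(1) h(1) gf h(2)]
        HoK_comp[OF f(2) g(1) h(1) g(2) h(2)] HoK_comp[OF f(1,2) h(1) f(3) hg]
        assoc[OF f(3) g(2) h(2)])
qed

text \<open>Whitehead's theorem. A trivial cofibration out of a fibrant object has a retraction, a
  trivial fibration onto a cofibrant object has a section, and both are two-sided inverses up to
  homotopy; a weak equivalence factors into one of each kind.\<close>

lemma weq_class_iso:
  assumes X: "bifibrant X" and Y: "bifibrant Y" and f: "f \<in> mhom X Y" "f \<in> Weq M"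
  shows "is_iso (HoK M) (cls f)"
proof -
  obtain Z j q where jq: "j \<in> mhom X Z" "q \<in> mhom Z Y" "j \<in> Cof M" "q \<in> Fib M" "q \<in> Weq M" "q \<cdot> j = f"
    using factor_cof[OF f(1)] by metis
  have jW: "j \<in> Weq M" using weq_cancel_left[OF jq(1,2,5)] f(2) jq(6) by simp
  have Z: "bifibrant Z"
    using X Y cofibrant_cod[OF _ jq(1,3)] fibrant_dom[OF _ jq(2,4)] unfolding bifibrant_def by blast
  note XO = bifibrant_obj[OF X] and YO = bifibrant_obj[OF Y] and ZO = bifibrant_obj[OF Z]
  obtain r where r: "r \<in> mhom Z X" "r \<cdot> j = Id X"
    using fibrant_extension[OF _ jq(1,3) jW id_in[OF XO]] X unfolding bifibrant_def by blast
  obtain s where s: "s \<in> mhom Y Z" "q \<cdot> s = Id Y"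
    using cofibrant_lift[OF _ jq(2,4,5) id_in[OF YO]] Y unfolding bifibrant_def by blast
  have jr: "j \<cdot> r \<in> mhom Z Z" and sq: "s \<cdot> q \<in> mhom Z Z" using comp_in r(1) s(1) jq(1,2) by blast+
  have "(j \<cdot> r) \<cdot> j = Id Z \<cdot> j"
    using assoc[OF jq(1) r(1) jq(1)] r(2) idr[OF jq(1)] idl[OF jq(1)] by simp
  then have "right_homotopic M (j \<cdot> r) (Id Z)"
    using right_homotopic_if_homotopic_on_trivial_cofibration[OF jq(1,3) jW jr id_in[OF ZO]]
      right_homotopic_refl[OF comp_in[OF jq(1) jr]] by simp
  then have 1: "cls (j \<cdot> r) = cls (Id Z)"
    using homotopic_iff_right[OF _ _ jr] class_eq_iff[OF _ _ jr id_in[OF ZO]] Z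
    unfolding bifibrant_def by blast
  have "q \<cdot> s \<cdot> q = q \<cdot> Id Z"
    using assoc[OF jq(2) s(1) jq(2)] s(2) idr[OF jq(2)] idl[OF jq(2)] by simp
  then have "left_homotopic M (s \<cdot> q) (Id Z)"
    by (rule left_homotopic_if_equal_after_trivial_fibration[OF jq(2,4,5) sq id_in[OF ZO]])
  then have 2: "cls (s \<cdot> q) = cls (Id Z)"
    using homotopic_iff_left[OF _ _ sq] class_eq_iff[OF _ _ sq id_in[OF ZO]] Z
    unfolding bifibrant_def by blast
  have rs: "r \<cdot> s \<in> mhom Y X" by (rule comp_in[OF s(1) r(1)])
  have "cls ((r \<cdot> s) \<cdot> f) = Comp (HoK M) (cls r) (Comp (HoK M) (cls (s \<cdot> q)) (cls j))"
  proof -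
    have "(r \<cdot> s) \<cdot> f = r \<cdot> (s \<cdot> q) \<cdot> j"
      using assoc[OF jq(1) sq r(1)] assoc[OF jq(1) jq(2) s(1)] assoc[OF f(1) s(1) r(1)] jq(6) by simp
    then show ?thesis
      using HoK_comp[OF X Z Z jq(1) sq] HoK_comp[OF X Z X comp_in[OF jq(1) sq] r(1)] by simp
  qed
  also have "\<dots> = cls (Id X)"
    using HoK_comp[OF X Z Z jq(1) id_in[OF ZO]] HoK_comp[OF X Z X jq(1) r(1)]
    by (simp add: 2 idl[OF jq(1)] r(2))
  finally have L: "cls ((r \<cdot> s) \<cdot> f) = cls (Id X)" .
  have "cls (f \<cdot> r \<cdot> s) = Comp (HoK M) (cls q) (Comp (HoK M) (cls (j \<cdot> r)) (cls s))"
  proof -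
    have "f \<cdot> r \<cdot> s = q \<cdot> (j \<cdot> r) \<cdot> s"
      using assoc[OF rs jq(1,2)] assoc[OF s(1) r(1) jq(1)] jq(6) by simp
    then show ?thesis
      using HoK_comp[OF Y Z Z s(1) jr] HoK_comp[OF Y Z Y comp_in[OF s(1) jr] jq(2)] by simp
  qed
  also have "\<dots> = cls (Id Y)"
    using HoK_comp[OF Y Z Z s(1) id_in[OF ZO]] HoK_comp[OF Y Z Y s(1) jq(2)]
    by (simp add: 1 idl[OF s(1)] s(2))
  finally have R: "cls (f \<cdot> r \<cdot> s) = cls (Id Y)" .
  show ?thesis
    by (rule is_isoI[OF class_hom[OF X Y f(1)] class_hom[OF Y X rs]])
      (simp_all add: HoK_comp[OF X Y X f(1) rs] HoK_comp[OF Y X Y rs f(1)] L R HoK_ident)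
qed

end


section \<open>The localization functor\<close>

locale model_with_replacement = model M for M :: "('o, 'a) model_cat" +
  fixes R :: "('o, 'a) replacement"
  assumes replacement: "is_replacement M R"
begin

lemma cmap:
  assumes "X \<in> Obj M"
  shows "cofibrant M (CRep R X)" "cmap R X \<in> mhom (CRep R X) X" "cmap R X \<in> Fib M"
    "cmap R X \<in> Weq M" "cofibrant M X \<Longrightarrow> CRep R X = X" "cofibrant M X \<Longrightarrow> cmap R X = Id X"
  using replacement assms unfolding is_replacement_def by blast+

lemma fmap:
  assumes "X \<in> Obj M"
  shows "fibrant M (FRep R X)" "fmap R X \<in> mhom X (FRep R X)" "fmap R X \<in> Cof M"
    "fmap R X \<in> Weq M" "fibrant M X \<Longrightarrow> FRep R X = X" "fibrant M X \<Longrightarrow> fmap R X = Id X"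
  using replacement assms unfolding is_replacement_def by blast+

lemma CLift:
  assumes "f \<in> mhom X Y"
  shows "CLift R f \<in> mhom (CRep R X) (CRep R Y)" "cmap R Y \<cdot> CLift R f = f \<cdot> cmap R X"
proof -
  note f = homD[OF cat assms]
  have "CLift R f \<in> hom M (CRep R (Dom M f)) (CRep R (Cod M f)) \<and>
       Comp M (cmap R (Cod M f)) (CLift R f) = Comp M f (cmap R (Dom M f))"
    using replacement f(1) unfolding is_replacement_def by blast
  then show "CLift R f \<in> mhom (CRep R X) (CRep R Y)" "cmap R Y \<cdot> CLift R f = f \<cdot> cmap R X"
    using f by simp_all
qed

lemma FLift:
  assumes "f \<in> mhom X Y"
  shows "FLift R f \<in> mhom (FRep R X) (FRep R Y)" "FLift R f \<cdot> fmap R X = fmap R Y \<cdot> f"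
proof -
  note f = homD[OF cat assms]
  have "FLift R f \<in> hom M (FRep R (Dom M f)) (FRep R (Cod M f)) \<and>
       Comp M (FLift R f) (fmap R (Dom M f)) = Comp M (fmap R (Cod M f)) f"
    using replacement f(1) unfolding is_replacement_def by blast
  then show "FLift R f \<in> mhom (FRep R X) (FRep R Y)" "FLift R f \<cdot> fmap R X = fmap R Y \<cdot> f"
    using f by simp_all
qed

lemma CLift_cofibrant:
  assumes "f \<in> mhom X Y" "cofibrant M X" "cofibrant M Y"
  shows "CLift R f = f"
proof -
  have "CLift R f \<in> mhom X Y" using CLift(1)[OF assms(1)] cmap(5) cofibrant_obj assms(2,3) by simp
  then show ?thesis
    using CLift(2)[OF assms(1)] cmap(6) cofibrant_obj assms idl idr by simp
qed

lemma FLift_fibrant: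
  assumes "f \<in> mhom X Y" "fibrant M X" "fibrant M Y"
  shows "FLift R f = f"
proof -
  have "X \<in> Obj M" "Y \<in> Obj M" using hom_obj[OF assms(1)] .
  moreover from this have "FLift R f \<in> mhom X Y" using FLift(1)[OF assms(1)] fmap(5) assms(2,3) by simp
  ultimately show ?thesis
    using FLift(2)[OF assms(1)] fmap(6) assms idl[OF assms(1)] idr by simp
qed

lemma FRep_cofibrant:
  assumes "cofibrant M X"
  shows "bifibrant (FRep R X)"
  using cofibrant_cod[OF assms fmap(2,3)] fmap(1) cofibrant_obj[OF assms]
  unfolding bifibrant_def by blast

text \<open>On the cofibrant \<open>X\<close> left and right homotopy into \<open>Y\<close> agree, and a right homotopy extends along
  the fibrant replacement map of \<open>X\<close>, a trivial cofibration.\<close>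

lemma extension_unique:
  assumes X: "cofibrant M X" and Y: "bifibrant Y"
    and u: "u \<in> mhom (FRep R X) Y" and v: "v \<in> mhom (FRep R X) Y"
    and uv: "left_homotopic M (u \<cdot> fmap R X) (v \<cdot> fmap R X)"
  shows "cls u = cls v"
proof -
  note XO = cofibrant_obj[OF X]
  have FX: "cofibrant M (FRep R X)" using FRep_cofibrant[OF X] unfolding bifibrant_def by blast
  have Yf: "fibrant M Y" using Y unfolding bifibrant_def by blast
  have "right_homotopic M (u \<cdot> fmap R X) (v \<cdot> fmap R X)"
    using left_iff_right_homotopic[OF X Yf comp_in[OF fmap(2)[OF XO] u]] uv by blast
  then have "right_homotopic M u v"
    by (rule right_homotopic_if_homotopic_on_trivial_cofibration[OF fmap(2-4)[OF XO] u v])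
  then show ?thesis
    using homotopic_iff_right[OF FX Yf u] class_eq_iff[OF FX Yf u v] by blast
qed

text \<open>The two choices made in the value on an arrow, a lift through a trivial fibration and an
  extension along a trivial cofibration, are each unique up to homotopy. Any arrow that fits into
  both squares therefore represents the value.\<close>

lemma localization_value:
  assumes f: "f \<in> mhom X Y"
    and a: "a \<in> mhom (CRep R X) (CRep R Y)" "cmap R Y \<cdot> a = f \<cdot> cmap R X"
    and b: "b \<in> mhom (FRep R (CRep R X)) (FRep R (CRep R Y))"
      "b \<cdot> fmap R (CRep R X) = fmap R (CRep R Y) \<cdot> a"
  shows "cls b = Far (loc_functor M R) f"
proof -
  have X: "X \<in> Obj M" and Y: "Y \<in> Obj M" using hom_obj[OF f] .
  note CX = cmap(1)[OF X] and CY = cmap(1)[OF Y]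
  note F = FLift[OF CLift(1)[OF f]]
  have "left_homotopic M a (CLift R f)"
    by (rule left_homotopic_if_equal_after_trivial_fibration[OF cmap(2-4)[OF Y] a(1) CLift(1)[OF f]])
      (simp add: a(2) CLift(2)[OF f])
  then have "left_homotopic M (fmap R (CRep R Y) \<cdot> a) (fmap R (CRep R Y) \<cdot> CLift R f)"
    by (rule left_homotopic_post[OF _ a(1) fmap(2)[OF cofibrant_obj[OF CY]]])
  then have "cls b = cls (FLift R (CLift R f))"
    using extension_unique[OF CX FRep_cofibrant[OF CY] b(1) F(1)] F(2) b(2) by simp
  then show ?thesis by (simp add: loc_functor_def)
qed

lemma localization_bifibrant: "X \<in> Obj M \<Longrightarrow> bifibrant (Fob (loc_functor M R) X)"
  using FRep_cofibrant[OF cmap(1)] by (simp add: loc_functor_def)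

theorem localization_functor: "is_functor M (HoK M) (loc_functor M R)"
proof (rule is_functorI[OF cat HoK_category])
  fix X assume X: "X \<in> Obj M"
  show "Fob (loc_functor M R) X \<in> Obj (HoK M)"
    using localization_bifibrant[OF X] by (simp add: HoK_obj)
  note CX = cmap(1)[OF X, THEN cofibrant_obj]
  note FX = FRep_cofibrant[OF cmap(1)[OF X], THEN bifibrant_obj]
  have "cls (Id (FRep R (CRep R X))) = Far (loc_functor M R) (Id X)"
    by (rule localization_value[OF id_in[OF X] id_in[OF CX] _ id_in[OF FX]])
      (simp_all add: idl[OF cmap(2)[OF X]] idr[OF cmap(2)[OF X]] idl[OF fmap(2)[OF CX]]
        idr[OF fmap(2)[OF CX]])
  then show "Far (loc_functor M R) (Id X) = Ident (HoK M) (Fob (loc_functor M R) X)"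
    by (simp add: HoK_ident loc_functor_def)
next
  fix X Y f assume f: "f \<in> mhom X Y"
  show "Far (loc_functor M R) f \<in> hom (HoK M) (Fob (loc_functor M R) X) (Fob (loc_functor M R) Y)"
    using class_hom[OF localization_bifibrant localization_bifibrant, OF hom_obj[OF f]]
      FLift(1)[OF CLift(1)[OF f]] by (simp add: loc_functor_def)
next
  fix X Y Z f g assume f: "f \<in> mhom X Y" and g: "g \<in> mhom Y Z"
  have X: "X \<in> Obj M" and Y: "Y \<in> Obj M" and Z: "Z \<in> Obj M" using hom_obj f g by blast+
  note cX = cmap(2)[OF X] and cY = cmap(2)[OF Y] and cZ = cmap(2)[OF Z]
  note fX = fmap(2)[OF cmap(1)[OF X, THEN cofibrant_obj]]
    and fY = fmap(2)[OF cmap(1)[OF Y, THEN cofibrant_obj]]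
    and fZ = fmap(2)[OF cmap(1)[OF Z, THEN cofibrant_obj]]
  note Cf = CLift[OF f] and Cg = CLift[OF g]
  note Ff = FLift[OF Cf(1)] and Fg = FLift[OF Cg(1)]
  have "cmap R Z \<cdot> CLift R g \<cdot> CLift R f = (g \<cdot> f) \<cdot> cmap R X"
    using assoc[OF Cf(1) Cg(1) cZ] Cg(2) assoc[OF Cf(1) cY g] Cf(2) assoc[OF cX f g] by simp
  moreover have "(FLift R (CLift R g) \<cdot> FLift R (CLift R f)) \<cdot> fmap R (CRep R X) =
      fmap R (CRep R Z) \<cdot> CLift R g \<cdot> CLift R f"
    using assoc[OF fX Ff(1) Fg(1)] Ff(2) assoc[OF Cf(1) fY Fg(1)] Fg(2) assoc[OF Cf(1) Cg(1) fZ]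
    by simp
  ultimately have "cls (FLift R (CLift R g) \<cdot> FLift R (CLift R f)) = Far (loc_functor M R) (g \<cdot> f)"
    by (rule localization_value[OF comp_in[OF f g] comp_in[OF Cf(1) Cg(1)] _ comp_in[OF Ff(1) Fg(1)]])
  then show "Far (loc_functor M R) (g \<cdot> f) =
      Comp (HoK M) (Far (loc_functor M R) g) (Far (loc_functor M R) f)"
    using HoK_comp[OF localization_bifibrant[OF X] localization_bifibrant[OF Y]
        localization_bifibrant[OF Z]] Ff(1) Fg(1) by (simp add: loc_functor_def)
qed

theorem localization_inverts_weq:
  assumes f: "f \<in> mhom X Y" "f \<in> Weq M"
  shows "is_iso (HoK M) (Far (loc_functor M R) f)"
proof -
  have X: "X \<in> Obj M" and Y: "Y \<in> Obj M" using hom_obj[OF f(1)] .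
  note CX = cmap(1)[OF X, THEN cofibrant_obj] and CY = cmap(1)[OF Y, THEN cofibrant_obj]
  note C = CLift[OF f(1)] and F = FLift[OF CLift(1)[OF f(1)]]
  have "CLift R f \<in> Weq M"
    using weq_cancel_left[OF C(1) cmap(2)[OF Y] cmap(4)[OF Y]] C(2)
      weq_comp[OF cmap(2)[OF X] f(1) cmap(4)[OF X] f(2)] by simp
  then have "FLift R (CLift R f) \<in> Weq M"
    using weq_cancel_right[OF fmap(2)[OF CX] F(1) fmap(4)[OF CX]] F(2)
      weq_comp[OF C(1) fmap(2)[OF CY] _ fmap(4)[OF CY]] by simp
  then have "is_iso (HoK M) (cls (FLift R (CLift R f)))"
    by (rule weq_class_iso[OF FRep_cofibrant FRep_cofibrant F(1), OF cmap(1)[OF X] cmap(1)[OF Y]])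
  then show ?thesis by (simp add: loc_functor_def)
qed

abbreviation loc :: "('o, 'a, 'o, 'a set) cat_functor" where
  "loc \<equiv> fcomp (loc_functor M R) inclusion"

lemma cofibrant_subcat_obj: "X \<in> Obj (cofibrant_subcat M) \<longleftrightarrow> cofibrant M X"
  using cofibrant_obj by (auto simp: cofibrant_subcat_def)

lemma cofibrant_subcat_hom:
  "f \<in> hom (cofibrant_subcat M) X Y \<longleftrightarrow> f \<in> mhom X Y \<and> cofibrant M X \<and> cofibrant M Y"
  by (simp add: cofibrant_subcat_def full_subcat_hom)

lemma loc_cofibrant:
  assumes "f \<in> mhom X Y" "cofibrant M X" "cofibrant M Y"
  shows "Far loc f = cls (FLift R f)"
  using CLift_cofibrant[OF assms] by (simp add: loc_functor_def)

lemma loc_bifibrant: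
  assumes "f \<in> mhom X Y" "bifibrant X" "bifibrant Y"
  shows "Far loc f = cls f"
  using CLift_cofibrant FLift_fibrant assms unfolding bifibrant_def by (simp add: loc_functor_def)

lemma loc_obj: "cofibrant M X \<Longrightarrow> Fob loc X = FRep R X"
  using cmap(5) cofibrant_obj by (simp add: loc_functor_def)

text \<open>The section is the inclusion of the bifibrant objects, with the fibrant replacement maps as
  \<open>r\<close>: on bifibrant objects localization is the identity on objects and passage to classes on
  arrows. The value of localization on the replacement map of \<open>X\<close> is the class of any extension of
  this map along itself, and the identity is one.\<close>

theorem localization_sectioned: "sectioned_functor (cofibrant_subcat M) (HoK M) loc (\<lambda>X. X) (fmap R)"
proof
  show "is_functor (cofibrant_subcat M) (HoK M) loc"
    unfolding cofibrant_subcat_def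
    by (rule functor_fcomp[OF inclusion_functor[OF cat] localization_functor])
next
  fix Y assume "Y \<in> Obj (HoK M)"
  then have Y: "bifibrant Y" by (simp add: HoK_obj)
  then show "Y \<in> Obj (cofibrant_subcat M)" unfolding cofibrant_subcat_obj bifibrant_def by blast
  show "Fob loc Y = Y"
    using loc_obj fmap(5) bifibrant_obj[OF Y] Y unfolding bifibrant_def by simp
next
  fix c Y Y' assume "c \<in> hom (HoK M) Y Y'"
  then obtain f where f: "bifibrant Y" "bifibrant Y'" "f \<in> mhom Y Y'" "c = cls f"
    unfolding HoK_hom_iff by blast
  have "f \<in> hom (cofibrant_subcat M) Y Y'"
    using f unfolding cofibrant_subcat_hom bifibrant_def by blast
  moreover have "Far loc f = c" using loc_bifibrant[OF f(3,1,2)] f(4) by (rule trans[OF _ sym])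
  ultimately show "\<exists>f\<in>hom (cofibrant_subcat M) Y Y'. Far loc f = c" by (rule bexI[rotated])
next
  fix X assume "X \<in> Obj (cofibrant_subcat M)"
  then have X: "cofibrant M X" by (simp add: cofibrant_subcat_obj)
  note XO = cofibrant_obj[OF X] and FX = FRep_cofibrant[OF X]
  show r: "fmap R X \<in> hom (cofibrant_subcat M) X (Fob loc X)"
    using X FX fmap(2)[OF XO] unfolding cofibrant_subcat_hom loc_obj[OF X] bifibrant_def by blast
  note FO = bifibrant_obj[OF FX]
  have r': "fmap R X \<in> mhom X (FRep R X)" by (rule fmap(2)[OF XO])
  have FF: "FRep R (FRep R X) = FRep R X" "fmap R (FRep R X) = Id (FRep R X)"
    using fmap(5,6)[OF FO] FX unfolding bifibrant_def by blast+
  have F: "FLift R (fmap R X) \<in> mhom (FRep R X) (FRep R X)"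
    "FLift R (fmap R X) \<cdot> fmap R X = Id (FRep R X) \<cdot> fmap R X"
    using FLift[OF r'] FF by simp_all
  have "cls (FLift R (fmap R X)) = cls (Id (FRep R X))"
    using extension_unique[OF X FX F(1) id_in[OF FO]] F(2)
      left_homotopic_refl[OF comp_in[OF r' F(1)]] by simp
  then show "Far loc (fmap R X) = Ident (HoK M) (Fob loc X)"
    using loc_cofibrant[OF r' X] FX unfolding bifibrant_def by (simp add: loc_obj[OF X] HoK_ident del: fcomp_sel)
next
  fix a X X' assume "a \<in> hom (cofibrant_subcat M) X X'"
  then have a: "a \<in> mhom X X'" "cofibrant M X" "cofibrant M X'" by (simp_all add: cofibrant_subcat_hom)
  note FX = FRep_cofibrant[OF a(2)] and FX' = FRep_cofibrant[OF a(3)]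
  note F = FLift[OF a(1)]
  have "Far loc (FLift R a) = Far loc a"
    using loc_bifibrant[OF F(1) FX FX'] loc_cofibrant[OF a] by simp
  moreover have "FLift R a \<in> hom (cofibrant_subcat M) (Fob loc X) (Fob loc X')"
    using F(1) FX FX' unfolding loc_obj[OF a(2)] loc_obj[OF a(3)] cofibrant_subcat_hom bifibrant_def
    by blast
  moreover have "Comp (cofibrant_subcat M) (FLift R a) (fmap R X) =
      Comp (cofibrant_subcat M) (fmap R X') a"
    using F(2) by (simp add: cofibrant_subcat_def)
  ultimately show "\<exists>b\<in>hom (cofibrant_subcat M) (Fob loc X) (Fob loc X'). Far loc b = Far loc a \<and>
      Comp (cofibrant_subcat M) b (fmap R X) = Comp (cofibrant_subcat M) (fmap R X') a"
    by blast
qed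

text \<open>The two inclusions of \<open>X\<close> into a cylinder have a common retraction that is a weak equivalence
  between cofibrant objects, so \<open>G\<close> cannot tell them apart.\<close>

lemma homotopic_identified:
  assumes G: "is_functor (cofibrant_subcat M) D G"
    and W: "\<And>f X Y. f \<in> mhom X Y \<Longrightarrow> f \<in> Weq M \<Longrightarrow> cofibrant M X \<Longrightarrow> cofibrant M Y \<Longrightarrow>
      is_iso D (Far G f)"
    and f: "f \<in> mhom X Y" and X: "cofibrant M X" and Y: "cofibrant M Y"
    and fg: "left_homotopic M f g"
  shows "Far G f = Far G g"
proof -
  obtain Q i0 i1 h where Q: "is_cylinder M X Q i0 i1" and h: "h \<in> mhom Q Y" "h \<cdot> i0 = f" "h \<cdot> i1 = g"
    by (rule left_homotopicE[OF fg f])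
  obtain p where p: "p \<in> mhom Q X" "p \<in> Weq M" "p \<cdot> i0 = Id X" "p \<cdot> i1 = Id X"
    by (rule cylinder_projection[OF Q])
  note Qc = cylinder_cofibrant[OF Q X]
  note i = cylinder_hom[OF Q]
  have H: "i0 \<in> hom (cofibrant_subcat M) X Q" "i1 \<in> hom (cofibrant_subcat M) X Q"
    "p \<in> hom (cofibrant_subcat M) Q X" "h \<in> hom (cofibrant_subcat M) Q Y"
    using i p(1) h(1) X Y Qc by (simp_all add: cofibrant_subcat_hom)
  have c: "Comp (cofibrant_subcat M) = Comp M" by (simp add: cofibrant_subcat_def)
  have "Comp D (Far G p) (Far G i0) = Comp D (Far G p) (Far G i1)"
    using functor_comp[OF G H(1,3)] functor_comp[OF G H(2,3)] p(3,4) by (simp add: c)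
  then have "Far G i0 = Far G i1"
    by (rule iso_cancel_left[OF functor_cat(2)[OF G] W[OF p(1,2) Qc X] functor_hom[OF G H(3)]
          functor_hom[OF G H(1)] functor_hom[OF G H(2)]])
  then show ?thesis
    using functor_comp[OF G H(1,4)] functor_comp[OF G H(2,4)] h(2,3) by (simp add: c)
qed

theorem faint_localization_extension:
  assumes G: "is_functor (cofibrant_subcat M) D G"
    and W: "\<And>f X Y. f \<in> mhom X Y \<Longrightarrow> f \<in> Weq M \<Longrightarrow> cofibrant M X \<Longrightarrow> cofibrant M Y \<Longrightarrow>
      is_iso D (Far G f)"
  shows "\<exists>K \<iota>. faint_extension (cofibrant_subcat M) (HoK M) D loc G K \<iota>"
proof -
  interpret S: sectioned_functor "cofibrant_subcat M" "HoK M" loc "\<lambda>X. X" "fmap R"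
    by (rule localization_sectioned)
  show ?thesis
  proof (rule S.faint_extension_exists[OF G])
    fix Y Y' f g
    assume Y: "Y \<in> Obj (HoK M)" "Y' \<in> Obj (HoK M)"
      and f: "f \<in> hom (cofibrant_subcat M) Y Y'" and g: "g \<in> hom (cofibrant_subcat M) Y Y'"
      and eq: "Far loc f = Far loc g"
    have b: "bifibrant Y" "bifibrant Y'" using Y by (simp_all add: HoK_obj)
    have fg: "f \<in> mhom Y Y'" "g \<in> mhom Y Y'" using f g by (simp_all add: cofibrant_subcat_hom)
    have "cls f = cls g" using eq loc_bifibrant[OF fg(1) b] loc_bifibrant[OF fg(2) b] by simp
    moreover have c: "cofibrant M Y" "cofibrant M Y'" "fibrant M Y'"
      using b unfolding bifibrant_def by blast+
    ultimately have lh: "left_homotopic M f g"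
      using class_eq_iff[OF c(1,3) fg] unfolding homotopic_def by blast
    show "Far G f = Far G g"
      by (rule homotopic_identified[OF G _ fg(1) c(1,2) lh]) (rule W)
  next
    fix X assume "X \<in> Obj (cofibrant_subcat M)"
    then have X: "cofibrant M X" by (simp add: cofibrant_subcat_obj)
    show "is_iso D (Far G (fmap R X))"
      using W[OF fmap(2,4)[OF cofibrant_obj[OF X]] X] FRep_cofibrant[OF X]
      unfolding bifibrant_def by blast
  qed
qed

end


section \<open>Derived functors\<close>

theorem theorem4:
  fixes M :: "('o, 'a) model_cat" and N :: "('p, 'b) model_cat"
    and R :: "('o, 'a) replacement" and S :: "('p, 'b) replacement"
    and F :: "('o, 'a, 'p, 'b) cat_functor"
  assumes "model_category M" and "model_category N"
    and "is_replacement M R" and "is_replacement N S"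
    and "is_functor M N F"
    and "\<And>f. f \<in> Weq M \<Longrightarrow> cofibrant M (Dom M f) \<Longrightarrow> cofibrant M (Cod M f) \<Longrightarrow> Far F f \<in> Weq N"
  shows "(\<exists>K \<epsilon>. Kan_derived_functor M N R S F K \<epsilon>) \<and>
    (\<exists>K \<iota>. F_derived_functor M N R S F K \<iota>) \<and>
    (\<forall>K \<iota>. F_derived_functor M N R S F K \<iota> \<longrightarrow> (\<exists>\<epsilon>. Kan_derived_functor M N R S F K \<epsilon>))"
proof -
  interpret M: model_with_replacement M R by unfold_locales (rule assms)+
  interpret N: model_with_replacement N S by unfold_locales (rule assms)+
  interpret L: sectioned_functor "cofibrant_subcat M" "HoK M" M.loc "\<lambda>X. X" "fmap R"
    by (rule M.localization_sectioned)
  let ?G = "fcomp (loc_functor N S) (fcomp F inclusion)"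
  have incl: "is_functor (cofibrant_subcat M) M inclusion"
    unfolding cofibrant_subcat_def by (rule inclusion_functor[OF M.cat])
  have G: "is_functor (cofibrant_subcat M) (HoK N) ?G"
    by (rule functor_fcomp[OF functor_fcomp[OF incl assms(5)] N.localization_functor])
  have W: "is_iso (HoK N) (Far ?G f)"
    if f: "f \<in> hom M X Y" "f \<in> Weq M" "cofibrant M X" "cofibrant M Y" for f X Y
  proof -
    have "Far F f \<in> Weq N" using assms(6)[of f] f homD(2,3)[OF M.cat f(1)] by simp
    then show ?thesis
      using N.localization_inverts_weq[OF functor_hom[OF assms(5) f(1)]] by simp
  qed
  have F_ex: "\<exists>K \<iota>. F_derived_functor M N R S F K \<iota>"
    unfolding F_derived_functor_def by (rule M.faint_localization_extension[OF G W])
  have "Kan_derived_functor M N R S F K \<iota>" if "F_derived_functor M N R S F K \<iota>" for K \<iota>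
    using L.faint_extension_is_Kan_extension that
    unfolding F_derived_functor_def Kan_derived_functor_def by blast
  then show ?thesis using F_ex by blast
qed

end
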